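(* There exist canonical formal series of words $G^\pm(a,b;\pi^\pm)$ such that the following holds. Let $\mathbb{F}$ be a field of characteristic zero, let $\mathfrak{g}$ be a Lie algebra over $\mathbb{F}$ with a vector space decomposition $\mathfrak{g}=\mathfrak{g}^-\oplus\mathfrak{g}^+$, let $s,t$ be commuting formal variables commuting with $\mathfrak{g}$, and let $\pi^\pm:\mathfrak{g}[[s,t]]\to\mathfrak{g}^\pm[[s,t]]$ be the corresponding projections. For $g^\pm\in\mathfrak{g}^\pm[[s,t]]$, let $\Psi^\pm\in\mathfrak{g}^\pm[[s,t]]$ be the unique elements with $e^{tg^+}e^{sg^-}=e^{s\Psi^-}e^{t\Psi^+}$ in $U(\mathfrak{g})[[s,t]]$. Then $$s\Psi^-,\ t\Psi^+\in\mathbb{F}\langle\langle sg^-,tg^+;\pi^\pm\rangle\rangle,$$ and $$s\Psi^-=G^-(sg^-,tg^+;\pi^\pm),\qquad t\Psi^+=G^+(sg^-,tg^+;\pi^\pm).$$ The lowest-order terms are given by $$G^-(sg^-,tg^+;\pi^\pm)=sg^-+\pi^-([tg^+,sg^-])+v^-(s,t),$$ $$G^+(sg^-,tg^+;\pi^\pm)=tg^++\pi^+([tg^+,sg^-])+v^+(s,t),$$ where $v^\pm(s,t)\in\mathbb{F}\langle\langle sg^-,tg^+;\pi^\pm\rangle\rangle^\pm$ are formal (possibly infinite) linear combinations of words involving at least three occurrences of $sg^-$ and $tg^+$ (including at least one of each).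
   Context: $\mathfrak{g}[[s,t]]$ is the Lie algebra of formal power series with coefficients in $\mathfrak{g}$; $U(\mathfrak{g})$ is the universal enveloping algebra. Existence and uniqueness of $\Psi^\pm$ (given $g^\pm$) is a known fact (formal algebraic uniformization). A formal word of bidegree $(m,n)$ in symbols $a,b$ is a formal expression built from $a$ and $b$ by repeatedly applying a bracket $[\cdot,\cdot]$ and the unary operations $\pi^-,\pi^+$, involving exactly $m$ occurrences of $a$ and exactly $n$ occurrences of $b$. It is evaluated at $a=sg^-$, $b=tg^+$ using the bracket of $\mathfrak{g}[[s,t]]$ and the projections $\pi^\pm$; a word of bidegree $(m,n)$ evaluates to an element of $s^mt^n\mathfrak{g}[[s,t]]$. A canonical formal series of words is a formal sum over $m,n\ge 0$ of finite rational linear combinations of formal words of bidegree $(m,n)$, which is universal in the sense that it does not depend on $\mathbb{F}$, on the Lie algebra $\mathfrak{g}$, on its decomposition (or $\pi^\pm$), or on the elements $g^\pm$; $G^\pm(sg^-,tg^+;\pi^\pm)\in\mathfrak{g}[[s,t]]$ denotes its evaluation at $a=sg^-$, $b=tg^+$. $\mathbb{F}\langle\langle sg^-,tg^+;\pi^\pm\rangle\rangle\subset\mathfrak{g}[[s,t]]$ is the set of all formal (possibly infinite) linear combinations of words in $sg^-,tg^+$ and $\pi^\pm$, i.e. all sums $\sum_{m,n\ge0}w_{m,n}$ with $w_{m,n}$ in the $\mathbb{F}$-span of the evaluated words of bidegree $(m,n)$; it is a Lie subalgebra of $\mathfrak{g}[[s,t]]$ stable under $\pi^\pm$. $\mathbb{F}\langle\langle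 sg^-,tg^+;\pi^\pm\rangle\rangle^\pm$ denotes its intersection with $\mathfrak{g}^\pm[[s,t]]$. *)

theory Defs
  imports
    "HOL-Library.Poly_Mapping"
    "HOL-Computational_Algebra.Formal_Power_Series"
begin

unbundle fps_syntax

datatype lie_word =
    WA
  | WB
  | WBr lie_word lie_word
  | WPm lie_word
  | WPp lie_word

primrec bideg :: "lie_word \<Rightarrow> nat \<times> nat" where
  "bideg WA = (1, 0)"
| "bideg WB = (0, 1)"
| "bideg (WBr v w) = (fst (bideg v) + fst (bideg w), snd (bideg v) + snd (bideg w))"
| "bideg (WPm w) = bideg w"
| "bideg (WPp w) = bideg w"

text \<open>
  A finite rational linear combination of words is a list of (coefficient, word) pairs, read as
  their sum; entries may repeat.
\<close>

type_synonym word_comb = "(rat \<times> lie_word) list"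

definition canonical_series :: "(nat \<Rightarrow> nat \<Rightarrow> word_comb) \<Rightarrow> bool" where
  "canonical_series G \<longleftrightarrow> (\<forall>m n. \<forall>(c, w) \<in> set (G m n). bideg w = (m, n))"

locale lie_algebra = vector_space scl
  for scl :: "'f::field \<Rightarrow> 'g::ab_group_add \<Rightarrow> 'g" +
  fixes br :: "'g \<Rightarrow> 'g \<Rightarrow> 'g"
  assumes br_add_left: "br (x + y) z = br x z + br y z"
    and br_add_right: "br x (y + z) = br x y + br x z"
    and br_scale_left: "br (scl c x) y = scl c (br x y)"
    and br_scale_right: "br x (scl c y) = scl c (br x y)"
    and br_self: "br x x = 0"
    and jacobi: "br x (br y z) + br y (br z x) + br z (br x y) = 0"

locale lie_decomposition = lie_algebra scl br
  for scl :: "'f::field \<Rightarrow> 'g::ab_group_add \<Rightarrow> 'g" and br :: "'g \<Rightarrow> 'g \<Rightarrow> 'g" +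
  fixes gM gP :: "'g set"
  assumes subspace_gM: "subspace gM"
    and subspace_gP: "subspace gP"
    and gM_inter_gP: "gM \<inter> gP = {0}"
    and gM_plus_gP: "\<exists>y\<in>gM. \<exists>z\<in>gP. x = y + z"

definition proj_along :: "'g::ab_group_add set \<Rightarrow> 'g set \<Rightarrow> 'g \<Rightarrow> 'g" where
  "proj_along V W x = (THE y. y \<in> V \<and> x - y \<in> W)"

text \<open>
  A series in \<open>s, t\<close> is an \<open>fps\<close> in \<open>s\<close> whose coefficients are \<open>fps\<close> in \<open>t\<close>: the
  coefficient of \<open>s\<^sup>m t\<^sup>n\<close> in \<open>X\<close> is \<open>X $ m $ n\<close>. The variables commute
  with the coefficients even when these form a noncommutative ring.
\<close>

definition ser2 :: "(nat \<Rightarrow> nat \<Rightarrow> 'a) \<Rightarrow> 'a fps fps" where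
  "ser2 f = Abs_fps (\<lambda>m. Abs_fps (\<lambda>n. f m n))"

definition ser2_in :: "'a set \<Rightarrow> 'a fps fps set" where
  "ser2_in V = {X. \<forall>m n. X $ m $ n \<in> V}"

definition s_mult :: "'a::zero fps fps \<Rightarrow> 'a fps fps" where
  "s_mult X = ser2 (\<lambda>m n. if m = 0 then 0 else X $ (m - 1) $ n)"

definition t_mult :: "'a::zero fps fps \<Rightarrow> 'a fps fps" where
  "t_mult X = ser2 (\<lambda>m n. if n = 0 then 0 else X $ m $ (n - 1))"

definition ser2_scl :: "('f \<Rightarrow> 'g \<Rightarrow> 'g) \<Rightarrow> 'f \<Rightarrow> 'g fps fps \<Rightarrow> 'g fps fps" where
  "ser2_scl scl c X = ser2 (\<lambda>m n. scl c (X $ m $ n))"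

definition ser2_br ::
    "('g \<Rightarrow> 'g \<Rightarrow> 'g::comm_monoid_add) \<Rightarrow> 'g fps fps \<Rightarrow> 'g fps fps \<Rightarrow> 'g fps fps" where
  "ser2_br br X Y =
     ser2 (\<lambda>m n. \<Sum>i\<le>m. \<Sum>j\<le>n. br (X $ i $ j) (Y $ (m - i) $ (n - j)))"

definition ser2_proj ::
    "'g::ab_group_add set \<Rightarrow> 'g set \<Rightarrow> 'g fps fps \<Rightarrow> 'g fps fps" where
  "ser2_proj V W X = ser2 (\<lambda>m n. proj_along V W (X $ m $ n))"

text \<open>
  The sum \<open>\<Sum>\<^sub>m\<^sub>,\<^sub>n w m n\<close> of a family with \<open>w m n\<close> divisible by \<open>s\<^sup>m t\<^sup>n\<close>; the omitted
  summands do not contribute to the coefficient of \<open>s\<^sup>i t\<^sup>j\<close>.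
\<close>

definition ser2_sum :: "(nat \<Rightarrow> nat \<Rightarrow> 'g::comm_monoid_add fps fps) \<Rightarrow> 'g fps fps" where
  "ser2_sum w = ser2 (\<lambda>i j. \<Sum>m\<le>i. \<Sum>n\<le>j. w m n $ i $ j)"

primrec eval_word ::
    "('g \<Rightarrow> 'g \<Rightarrow> 'g::ab_group_add) \<Rightarrow> 'g set \<Rightarrow> 'g set \<Rightarrow> 'g fps fps \<Rightarrow> 'g fps fps \<Rightarrow>
     lie_word \<Rightarrow> 'g fps fps" where
  "eval_word br gM gP a b WA = a"
| "eval_word br gM gP a b WB = b"
| "eval_word br gM gP a b (WBr v w) =
     ser2_br br (eval_word br gM gP a b v) (eval_word br gM gP a b w)"
| "eval_word br gM gP a b (WPm w) = ser2_proj gM gP (eval_word br gM gP a b w)"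
| "eval_word br gM gP a b (WPp w) = ser2_proj gP gM (eval_word br gM gP a b w)"

definition eval_comb ::
    "('f::field_char_0 \<Rightarrow> 'g \<Rightarrow> 'g) \<Rightarrow> ('g \<Rightarrow> 'g \<Rightarrow> 'g::ab_group_add) \<Rightarrow> 'g set \<Rightarrow> 'g set \<Rightarrow>
     'g fps fps \<Rightarrow> 'g fps fps \<Rightarrow> word_comb \<Rightarrow> 'g fps fps" where
  "eval_comb scl br gM gP a b cs =
     (\<Sum>(c, w)\<leftarrow>cs. ser2_scl scl (of_rat c) (eval_word br gM gP a b w))"

definition eval_series ::
    "('f::field_char_0 \<Rightarrow> 'g \<Rightarrow> 'g) \<Rightarrow> ('g \<Rightarrow> 'g \<Rightarrow> 'g::ab_group_add) \<Rightarrow> 'g set \<Rightarrow> 'g set \<Rightarrow>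
     'g fps fps \<Rightarrow> 'g fps fps \<Rightarrow> (nat \<Rightarrow> nat \<Rightarrow> word_comb) \<Rightarrow> 'g fps fps" where
  "eval_series scl br gM gP a b G = ser2_sum (\<lambda>m n. eval_comb scl br gM gP a b (G m n))"

definition word_span ::
    "('f::field \<Rightarrow> 'g \<Rightarrow> 'g) \<Rightarrow> ('g \<Rightarrow> 'g \<Rightarrow> 'g::ab_group_add) \<Rightarrow> 'g set \<Rightarrow> 'g set \<Rightarrow>
     'g fps fps \<Rightarrow> 'g fps fps \<Rightarrow> nat \<Rightarrow> nat \<Rightarrow> 'g fps fps set" where
  "word_span scl br gM gP a b m n =
     module.span (ser2_scl scl) {eval_word br gM gP a b w |w. bideg w = (m, n)}"

text \<open>
  Formal infinite linear combinations of the words whose bidegree satisfies \<open>P\<close>.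
\<close>

definition word_series_on ::
    "(nat \<Rightarrow> nat \<Rightarrow> bool) \<Rightarrow>
     ('f::field \<Rightarrow> 'g \<Rightarrow> 'g) \<Rightarrow> ('g \<Rightarrow> 'g \<Rightarrow> 'g::ab_group_add) \<Rightarrow> 'g set \<Rightarrow> 'g set \<Rightarrow>
     'g fps fps \<Rightarrow> 'g fps fps \<Rightarrow> 'g fps fps set" where
  "word_series_on P scl br gM gP a b =
     {ser2_sum w |w. \<forall>m n. w m n \<in> (if P m n then word_span scl br gM gP a b m n else {0})}"

definition word_series ::
    "('f::field \<Rightarrow> 'g \<Rightarrow> 'g) \<Rightarrow> ('g \<Rightarrow> 'g \<Rightarrow> 'g::ab_group_add) \<Rightarrow> 'g set \<Rightarrow> 'g set \<Rightarrow>
     'g fps fps \<Rightarrow> 'g fps fps \<Rightarrow> 'g fps fps set" where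
  "word_series scl br gM gP a b =
     {ser2_sum w |w. \<forall>m n. w m n \<in> word_span scl br gM gP a b m n}"

text \<open>
  \<open>U(\<gg>)\<close> is presented as the free associative algebra on the underlying set of \<open>\<gg>\<close>, i.e. the
  monoid algebra of the free monoid, modulo the two-sided ideal that makes the generator map linear
  (this yields the tensor algebra) and identifies commutators with brackets.
\<close>

datatype 'g free_mon = Mon "'g list"

instantiation free_mon :: (type) monoid_add
begin

definition zero_free_mon :: "'a free_mon" where
  "0 = Mon []"

fun plus_free_mon :: "'a free_mon \<Rightarrow> 'a free_mon \<Rightarrow> 'a free_mon" where
  "Mon xs + Mon ys = Mon (xs @ ys)"

instance
proof
  fix p q r :: "'a free_mon"
  show "p + q + r = p + (q + r)" by (cases p; cases q; cases r) simp
  show "0 + p = p" by (cases p) (simp add: zero_free_mon_def)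
  show "p + 0 = p" by (cases p) (simp add: zero_free_mon_def)
qed

end

type_synonym ('g, 'f) free_alg = "'g free_mon \<Rightarrow>\<^sub>0 'f"

definition scalar :: "'f::field \<Rightarrow> ('g, 'f) free_alg" where
  "scalar c = Poly_Mapping.single 0 c"

definition gen :: "'g \<Rightarrow> ('g, 'f::field) free_alg" where
  "gen x = Poly_Mapping.single (Mon [x]) 1"

inductive_set uea_ideal ::
    "('f::field \<Rightarrow> 'g \<Rightarrow> 'g) \<Rightarrow> ('g \<Rightarrow> 'g \<Rightarrow> 'g::ab_group_add) \<Rightarrow> ('g, 'f) free_alg set"
  for scl :: "'f::field \<Rightarrow> 'g \<Rightarrow> 'g" and br :: "'g \<Rightarrow> 'g \<Rightarrow> 'g::ab_group_add" where
  gen_add: "gen (x + y) - (gen x + gen y) \<in> uea_ideal scl br"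
| gen_scale: "gen (scl c x) - scalar c * gen x \<in> uea_ideal scl br"
| gen_bracket: "gen x * gen y - gen y * gen x - gen (br x y) \<in> uea_ideal scl br"
| add: "p \<in> uea_ideal scl br \<Longrightarrow> q \<in> uea_ideal scl br \<Longrightarrow> p + q \<in> uea_ideal scl br"
| mult_left: "p \<in> uea_ideal scl br \<Longrightarrow> r * p \<in> uea_ideal scl br"
| mult_right: "p \<in> uea_ideal scl br \<Longrightarrow> p * r \<in> uea_ideal scl br"

text \<open>
  Elements of \<open>U(\<gg>)[[s,t]]\<close> are represented by series over the free algebra, and their equality is
  coefficientwise congruence modulo the ideal.
\<close>

definition uea_ser2_eq ::
    "('f::field \<Rightarrow> 'g \<Rightarrow> 'g) \<Rightarrow> ('g \<Rightarrow> 'g \<Rightarrow> 'g::ab_group_add) \<Rightarrow>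
     ('g, 'f) free_alg fps fps \<Rightarrow> ('g, 'f) free_alg fps fps \<Rightarrow> bool" where
  "uea_ser2_eq scl br X Y \<longleftrightarrow> (\<forall>m n. X $ m $ n - Y $ m $ n \<in> uea_ideal scl br)"

definition ser2_gen :: "'g fps fps \<Rightarrow> ('g, 'f::field) free_alg fps fps" where
  "ser2_gen x = ser2 (\<lambda>m n. gen (x $ m $ n))"

text \<open>
  Exponential of a series with zero constant term in \<open>U(\<gg>)[[s,t]]\<close>: \<open>X ^ k\<close> has no terms of
  total degree below \<open>k\<close>, so the exponential series is truncated at \<open>k = m + n\<close>.
\<close>

definition ser2_exp :: "('g, 'f::field_char_0) free_alg fps fps \<Rightarrow> ('g, 'f) free_alg fps fps" where
  "ser2_exp X = ser2 (\<lambda>m n. \<Sum>k\<le>m + n. scalar (1 / fact k) * ((X ^ k) $ m $ n))"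

text \<open>
  The existential quantifier over canonical series ranges outside all fields and all Lie algebras,
  hence outside all types, so the witnesses are constants of a type not involving either.

  They solve, in an auxiliary variable \<open>u\<close> recording the total degree of words, the factorization
  \<open>e\<^bsup>ub\<^esup> e\<^bsup>ua\<^esup> = e\<^bsup>A(u)\<^esup> e\<^bsup>B(u)\<^esup>\<close> with \<open>A\<close> in the image of \<open>\<pi>\<^sup>-\<close> and \<open>B\<close> in that of \<open>\<pi>\<^sup>+\<close>. Taking
  logarithmic derivatives in \<open>u\<close> and applying \<open>e\<^bsup>- ad A\<^esup>\<close> gives
  \<open>\<psi>(ad A) A' + \<phi>(ad B) B' = e\<^bsup>- ad A\<^esup> (b + e\<^bsup>u ad b\<^esup> a)\<close>
  with \<open>\<phi>(z) = (e\<^sup>z - 1) / z\<close> and \<open>\<psi>(z) = \<phi>(- z)\<close>. The coefficient of \<open>u\<^sup>k\<close>, projected by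
  \<open>\<pi>\<^sup>\<plusminus>\<close>, determines the next coefficients \<open>A\<^sub>k\<^sub>+\<^sub>1\<close> and \<open>B\<^sub>k\<^sub>+\<^sub>1\<close> from the earlier ones.
\<close>

definition wc_scale :: "rat \<Rightarrow> word_comb \<Rightarrow> word_comb" where
  "wc_scale c xs = map (\<lambda>(d, w). (c * d, w)) xs"

definition wc_br :: "word_comb \<Rightarrow> word_comb \<Rightarrow> word_comb" where
  "wc_br xs ys = concat (map (\<lambda>(c, v). map (\<lambda>(d, w). (c * d, WBr v w)) ys) xs)"

definition wc_map :: "(lie_word \<Rightarrow> lie_word) \<Rightarrow> word_comb \<Rightarrow> word_comb" where
  "wc_map f xs = map (\<lambda>(c, w). (c, f w)) xs"

definition gr_br :: "(nat \<Rightarrow> word_comb) \<Rightarrow> (nat \<Rightarrow> word_comb) \<Rightarrow> nat \<Rightarrow> word_comb" where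
  "gr_br X Y k = concat (map (\<lambda>i. wc_br (X i) (Y (k - i))) [0..<Suc k])"

definition gr_deriv :: "(nat \<Rightarrow> word_comb) \<Rightarrow> nat \<Rightarrow> word_comb" where
  "gr_deriv X k = wc_scale (of_nat (Suc k)) (X (Suc k))"

text \<open>
  \<open>\<Sum>\<^sub>p c p (ad X)\<^sup>p Y\<close> in degree \<open>k\<close>; the sum stops at \<open>p = k\<close> since \<open>X\<close> has no term in degree 0.
\<close>

definition gr_ad_series ::
    "(nat \<Rightarrow> rat) \<Rightarrow> (nat \<Rightarrow> word_comb) \<Rightarrow> (nat \<Rightarrow> word_comb) \<Rightarrow> nat \<Rightarrow> word_comb" where
  "gr_ad_series c X Y k = concat (map (\<lambda>p. wc_scale (c p) ((gr_br X ^^ p) Y k)) [0..<Suc k])"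

definition gr_source :: "nat \<Rightarrow> word_comb" where
  "gr_source k = (1 / fact k, (WBr WB ^^ k) WA) # (if k = 0 then [(1, WB)] else [])"

definition gr_rhs :: "(nat \<Rightarrow> word_comb) \<Rightarrow> (nat \<Rightarrow> word_comb) \<Rightarrow> nat \<Rightarrow> word_comb" where
  "gr_rhs A B k =
     gr_ad_series (\<lambda>p. (- 1) ^ p / fact p) A gr_source k
     @ gr_ad_series (\<lambda>p. if p = 0 then 0 else - ((- 1) ^ p / fact (Suc p))) A (gr_deriv A) k
     @ gr_ad_series (\<lambda>p. if p = 0 then 0 else - (1 / fact (Suc p))) B (gr_deriv B) k"

primrec gr_solution :: "nat \<Rightarrow> (nat \<Rightarrow> word_comb) \<times> (nat \<Rightarrow> word_comb)" where
  "gr_solution 0 = ((\<lambda>_. [])(1 := [(1, WA)]), (\<lambda>_. [])(1 := [(1, WB)]))"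
| "gr_solution (Suc j) =
     (let (A, B) = gr_solution j;
          k = Suc j;
          rhs = wc_scale (1 / of_nat (Suc k)) (gr_rhs A B k)
      in (A(Suc k := wc_map WPm rhs), B(Suc k := wc_map WPp rhs)))"

definition G_minus :: "nat \<Rightarrow> nat \<Rightarrow> word_comb" where
  "G_minus m n = filter (\<lambda>(c, w). bideg w = (m, n)) (fst (gr_solution (m + n)) (m + n))"

definition G_plus :: "nat \<Rightarrow> nat \<Rightarrow> word_comb" where
  "G_plus m n = filter (\<lambda>(c, w). bideg w = (m, n)) (snd (gr_solution (m + n)) (m + n))"

end

theory Submission
  imports Defs
begin

text \<open>
  Existence: with \<open>A\<close>, \<open>B\<close> the evaluated solution of the recursion, graded by an auxiliary variable
  \<open>u\<close> that counts the letters \<open>a\<close>, \<open>b\<close>, both \<open>e\<^bsup>ub\<^esup> e\<^bsup>ua\<^esup>\<close> and \<open>e\<^bsup>A(u)\<^esup> e\<^bsup>B(u)\<^esup>\<close> satisfy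
  \<open>Z' = (b + e\<^bsup>u ad b\<^esup> a) Z\<close>, \<open>Z(0) = 1\<close>, so they agree, and one sets \<open>u = 1\<close>. Uniqueness: two
  factorizations that agree below total \<open>s, t\<close>-degree \<open>d\<close> differ in degree \<open>d\<close> by an element of
  \<open>\<gg>\<^sup>- + \<gg>\<^sup>+\<close> that vanishes in \<open>U(\<gg>)\<close>. It then vanishes in \<open>\<gg>\<close>, because \<open>\<gg> \<rightarrow> U(\<gg>)\<close> is injective.
  For the latter, each coordinate functional of \<open>\<gg>\<close> is extended to the free algebra through a
  straightening of words which is confluent by the Jacobi identity. Quotients by the ideal, by
  powers of \<open>u\<close> and by \<open>s, t\<close>-degree are all handled as congruences modulo a decreasing family of ideals, so that every
  exponential is a finite sum.
\<close>

section \<open>Injectivity of the map into the enveloping algebra\<close>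

text \<open>The series \<open>a\<close> and \<open>b\<close> have arbitrary coefficients in s and t,
  so a derivative in s or t would also hit the data. In the extra variable u they are constants:
  \<open>u b\<close> commutes with its own derivative, and the u-degree counts letters. Setting u =
  1 at the end is legitimate because a word with k letters has a value of s,t-degree at least k.
  Before passing to the quotient, \<open>gen\<close> is not even additive. Hence an identity of the
  enveloping algebra is always membership of a difference in an ideal, and each passage from
  brackets to commutators carries error terms lying in that ideal. Of the PBW theorem only a
  fragment is required: the coefficient of a single letter in the normal form of a word, not a basis
  of the whole algebra. The formal lists do contain words in one letter only, such as
  \<open>[a, a]\<close>. They vanish on evaluation because \<open>a\<close> lies in one summand and
  \<open>b\<close> in the other, which is why the remainders involve both letters. Characteristic
  zero enters through rational scalars, above all the division by k + 1 in the recursion and in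
  integrating the differential equation.\<close>

context lie_algebra
begin

text \<open>Coordinates in a Hamel basis: \<open>extend_basis {}\<close> is some basis of the whole
  space, so infinite dimension is covered.\<close>

definition coord :: "'g \<Rightarrow> 'g \<Rightarrow> 'f" where
  "coord = representation (extend_basis {})"

lemma coord_add: "coord (x + y) c = coord x c + coord y c"
  and coord_scale: "coord (scl r x) c = r * coord x c"
  and finite_coord: "finite {c. coord x c \<noteq> 0}"
  and sum_coord: "(\<Sum>c | coord x c \<noteq> 0. scl (coord x c) c) = x"
proof -
  have ind: "independent (extend_basis {})" and spn: "span (extend_basis {}) = UNIV"
    using independent_empty by (simp_all add: independent_extend_basis span_extend_basis)
  show "coord (x + y) c = coord x c + coord y c"
    unfolding coord_def by (simp add: representation_add[OF ind] spn)
  show "coord (scl r x) c = r * coord x c"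
    unfolding coord_def by (simp add: representation_scale[OF ind] spn)
  show "finite {c. coord x c \<noteq> 0}"
    unfolding coord_def by (rule finite_representation)
  show "(\<Sum>c | coord x c \<noteq> 0. scl (coord x c) c) = x"
    unfolding coord_def by (rule sum_nonzero_representation_eq[OF ind]) (simp add: spn)
qed

text \<open>The functional with prescribed values on the basis. Values of \<open>f\<close> off the
  basis are never read, so \<open>f\<close> may be given by a rule on arbitrary elements that is far
  from linear.\<close>

definition lin_ext :: "('g \<Rightarrow> 'f) \<Rightarrow> 'g \<Rightarrow> 'f" where
  "lin_ext f x = (\<Sum>c | coord x c \<noteq> 0. coord x c * f c)"

lemma lin_ext_superset:
  assumes "finite S" "{c. coord x c \<noteq> 0} \<subseteq> S"
  shows "lin_ext f x = (\<Sum>c\<in>S. coord x c * f c)"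
  unfolding lin_ext_def using assms by (intro sum.mono_neutral_left) auto

lemma lin_ext_add: "lin_ext f (x + y) = lin_ext f x + lin_ext f y"
proof -
  let ?S = "{c. coord x c \<noteq> 0} \<union> {c. coord y c \<noteq> 0}"
  have fin: "finite ?S" using finite_coord by blast
  have "{c. coord (x + y) c \<noteq> 0} \<subseteq> ?S" by (auto simp: coord_add)
  then show ?thesis
    by (subst (1 2 3) lin_ext_superset[OF fin])
      (auto simp: coord_add ring_distribs sum.distrib)
qed

lemma lin_ext_scale: "lin_ext f (scl r x) = r * lin_ext f x"
proof -
  have "{c. coord (scl r x) c \<noteq> 0} \<subseteq> {c. coord x c \<noteq> 0}" by (auto simp: coord_scale)
  then show ?thesis
    by (subst (1 2) lin_ext_superset[OF finite_coord])
      (auto simp: coord_scale sum_distrib_left mult.assoc)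
qed

lemma lin_ext_zero: "lin_ext f 0 = 0"
  using lin_ext_scale[of f 0 0] by simp

lemma lin_ext_neg: "lin_ext f (- x) = - lin_ext f x"
  using lin_ext_scale[of f "-1" x] by simp

lemma lin_ext_sum: "lin_ext f (\<Sum>c\<in>S. g c) = (\<Sum>c\<in>S. lin_ext f (g c))"
  by (induct S rule: infinite_finite_induct) (simp_all add: lin_ext_add lin_ext_zero)

lemma lin_ext_fun_add: "lin_ext (\<lambda>c. f c + g c) x = lin_ext f x + lin_ext g x"
  by (simp add: lin_ext_def ring_distribs sum.distrib)

lemma lin_ext_fun_diff: "lin_ext (\<lambda>c. f c - g c) x = lin_ext f x - lin_ext g x"
  by (simp add: lin_ext_def ring_distribs sum_subtractf)

lemma lin_ext_swap:
  "lin_ext (\<lambda>c. lin_ext (\<lambda>d. f c d) y) x = lin_ext (\<lambda>d. lin_ext (\<lambda>c. f c d) x) y"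
  unfolding lin_ext_def sum_distrib_left
  by (subst sum.swap) (simp add: mult.left_commute)

text \<open>Both sides are linear in \<open>x\<close> and agree on the basis. Used with
  \<open>T\<close> a bracket with a fixed element.\<close>

lemma lin_ext_comp:
  assumes "\<And>x y. T (x + y) = T x + T y" "\<And>r x. T (scl r x) = scl r (T x)"
  shows "lin_ext (\<lambda>c. lin_ext f (T c)) x = lin_ext f (T x)"
proof -
  have T0: "T 0 = 0" using assms(2)[of 0 0] by simp
  have Tsum: "T (\<Sum>c\<in>S. g c) = (\<Sum>c\<in>S. T (g c))" for S :: "'g set" and g
    by (induct S rule: infinite_finite_induct) (simp_all add: assms(1) T0)
  have "lin_ext f (T x) = lin_ext f (T (\<Sum>c | coord x c \<noteq> 0. scl (coord x c) c))"
    by (simp add: sum_coord)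
  also have "\<dots> = (\<Sum>c | coord x c \<noteq> 0. coord x c * lin_ext f (T c))"
    by (simp add: Tsum lin_ext_sum assms(2) lin_ext_scale)
  finally show ?thesis by (simp add: lin_ext_def)
qed

lemma br_zero: "br 0 y = 0" "br x 0 = 0"
  using br_add_left[of 0 0 y] br_add_right[of x 0 0] by auto

lemma br_neg: "br (- x) y = - br x y" "br x (- y) = - br x y"
  using br_add_left[of x "- x" y] br_add_right[of x y "- y"] br_zero
  by (auto simp: eq_neg_iff_add_eq_0 add.commute)

lemma br_anti: "br y x = - br x y"
proof -
  have "br y x + br x y = br (x + y) (x + y)"
    by (simp only: br_add_left br_add_right br_self[of x] br_self[of y] add_0_left add_0_right
        add.commute)
  then show ?thesis by (simp add: br_self eq_neg_iff_add_eq_0)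
qed

end

section \<open>Straightening of words over a totally ordered alphabet\<close>

locale ordered_lie_algebra = lie_algebra scl br
  for scl :: "'f::field \<Rightarrow> 'g::ab_group_add \<Rightarrow> 'g" and br :: "'g \<Rightarrow> 'g \<Rightarrow> 'g" +
  fixes lt :: "'g \<Rightarrow> 'g \<Rightarrow> bool"
  assumes lt_irrefl: "\<not> lt x x"
    and lt_trans: "lt x y \<Longrightarrow> lt y z \<Longrightarrow> lt x z"
    and lt_total: "lt x y \<or> x = y \<or> lt y x"
begin

fun inversions :: "'g list \<Rightarrow> nat" where
  "inversions [] = 0"
| "inversions (x # xs) = length (filter (\<lambda>y. lt y x) xs) + inversions xs"

lemma inversions_swap: "lt y x \<Longrightarrow> inversions (u @ y # x # v) < inversions (u @ x # y # v)"
  by (induct u) (auto dest: lt_trans simp: lt_irrefl)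

definition descent :: "'g list \<Rightarrow> 'g list \<times> 'g \<times> 'g \<times> 'g list \<Rightarrow> bool" where
  "descent w = (\<lambda>(u, x, y, v). w = u @ x # y # v \<and> lt y x)"

definition some_descent :: "'g list \<Rightarrow> 'g list \<times> 'g \<times> 'g \<times> 'g list" where
  "some_descent w = (SOME q. descent w q)"

lemma some_descentD:
  assumes "(u, x, y, v) = some_descent w" "descent w q"
  shows "w = u @ x # y # v \<and> lt y x"
  using someI[of "descent w", OF assms(2)] assms(1)[symmetric] by (simp add: some_descent_def descent_def)

text \<open>The coefficient of the one-letter word \<open>[b]\<close> after rewriting
  \<open>x y\<close> as \<open>y x + [x, y]\<close> at descents, with the bracket expanded in the
  basis. The descent is an arbitrary choice, so independence of it has to be proved. A swap lowers
  the inversions and a bracket lowers the length, hence the lexicographic measure.\<close>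

function normal_coeff :: "'g \<Rightarrow> 'g list \<Rightarrow> 'f" where
  "normal_coeff b w =
     (if \<exists>q. descent w q then
        (case some_descent w of (u, x, y, v) \<Rightarrow>
           normal_coeff b (u @ y # x # v) + lin_ext (\<lambda>c. normal_coeff b (u @ c # v)) (br x y))
      else if w = [b] then 1 else 0)"
  by pat_completeness auto
termination
  by (relation "measures [\<lambda>(b, w). length w, \<lambda>(b, w). inversions w]")
    (auto dest!: some_descentD simp: inversions_swap)

declare normal_coeff.simps [simp del]

abbreviation straighten :: "'g \<Rightarrow> 'g list \<Rightarrow> 'g \<Rightarrow> 'g \<Rightarrow> 'g list \<Rightarrow> 'f" where
  "straighten b u x y v \<equiv>
     normal_coeff b (u @ y # x # v) + lin_ext (\<lambda>c. normal_coeff b (u @ c # v)) (br x y)"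

abbreviation smaller :: "'g list \<Rightarrow> 'g list \<Rightarrow> bool" where
  "smaller w' w \<equiv> (w', w) \<in> measures [length, inversions]"

text \<open>By totality, two neighbours are equal or form a descent in one of the two orders. The
  ascending case is the descending one read backwards, with the sign from antisymmetry of the
  bracket.\<close>

lemma normal_coeff_commute_if_descents:
  assumes "\<And>u' x' y' v'.
      u' @ x' # y' # v' = u @ x # y # v \<or> u' @ x' # y' # v' = u @ y # x # v \<Longrightarrow> lt y' x' \<Longrightarrow>
      normal_coeff b (u' @ x' # y' # v') = straighten b u' x' y' v'"
  shows "normal_coeff b (u @ x # y # v) = straighten b u x y v"
proof -
  consider "lt x y" | "x = y" | "lt y x" using lt_total by blast
  then show ?thesis
  proof cases
    case 1
    then have "normal_coeff b (u @ y # x # v) = straighten b u y x v"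
      using assms[of u y x v] by simp
    then show ?thesis using br_anti[of y x] by (simp add: lin_ext_neg)
  next
    case 2
    then show ?thesis by (simp add: br_self lin_ext_zero)
  next
    case 3
    then show ?thesis using assms[of u x y v] by simp
  qed
qed

text \<open>The diamond argument: two descents either share a letter, and the Jacobi identity closes
  the diamond, or are disjoint, and the two rewritings commute. \<open>IH\<close> may be applied
  only when both words of a swapped pair lie below \<open>w\<close>.\<close>

lemma straighten_confluent:
  assumes IH: "\<And>u x y v. smaller (u @ x # y # v) w \<Longrightarrow> smaller (u @ y # x # v) w \<Longrightarrow>
      normal_coeff b (u @ x # y # v) = straighten b u x y v"
    and w1: "w = u @ x # y # v" and l1: "lt y x"
    and w2: "w = u' @ x' # y' # v'" and l2: "lt y' x'"
    and len: "length u < length u'"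
  shows "straighten b u x y v = straighten b u' x' y' v'"
proof -
  let ?N = "normal_coeff b"
  from w1 w2 len obtain r where r: "u' = u @ x # r" and r2: "y # v = r @ x' # y' # v'"
    by (auto simp: append_eq_append_conv2 Cons_eq_append_conv append_eq_Cons_conv)
  show ?thesis
  proof (cases r)
    case Nil
    then have eqs: "x' = y" "v = y' # v'" "u' = u @ [x]" using r r2 by auto
    define z where "z = y'"
    have w: "w = u @ x # y # z # v'" using w1 eqs z_def by simp
    have lzy: "lt z y" and lzx: "lt z x" using l1 l2 eqs z_def lt_trans by auto
    \<comment> \<open>Two routes from \<open>x y z\<close> to \<open>z y x\<close>:
      \<open>e1\<close> and \<open>e2\<close> continue after exchanging \<open>x\<close> and
      \<open>y\<close>, while \<open>e3\<close> and \<open>e4\<close> continue after exchanging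
      \<open>y\<close> and \<open>z\<close>.\<close>
    have e1: "?N (u @ y # x # z # v') = straighten b (u @ [y]) x z v'"
      using IH[of "u @ [y]" x z v'] inversions_swap[OF l1, of u "z # v'"]
        inversions_swap[OF lzx, of "u @ [y]" v'] by (auto simp: w)
    have e2: "?N (u @ y # z # x # v') = straighten b u y z (x # v')"
      using IH[of u y z "x # v'"] inversions_swap[OF l1, of u "z # v'"]
        inversions_swap[OF lzx, of "u @ [y]" v'] inversions_swap[OF lzy, of u "x # v'"]
      by (auto simp: w)
    have e3: "?N (u @ x # z # y # v') = straighten b u x z (y # v')"
      using IH[of u x z "y # v'"] inversions_swap[OF lzy, of "u @ [x]" v']
        inversions_swap[OF lzx, of u "y # v'"] by (auto simp: w)
    have e4: "?N (u @ z # x # y # v') = straighten b (u @ [z]) x y v'"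
      using IH[of "u @ [z]" x y v'] inversions_swap[OF lzy, of "u @ [x]" v']
        inversions_swap[OF lzx, of u "y # v'"] inversions_swap[OF l1, of "u @ [z]" v']
      by (auto simp: w)
    \<comment> \<open>With one bracket contracted the word is shorter than \<open>w\<close>, so its
      letters commute up to a further bracket, whatever their order.\<close>
    have comm: "?N (u @ c # d # v') - ?N (u @ d # c # v') =
        lin_ext (\<lambda>e. ?N (u @ e # v')) (br c d)" for c d
      using IH[of u c d v'] by (simp add: w)
    let ?f = "\<lambda>e. ?N (u @ e # v')"
    have c1: "lin_ext (\<lambda>c. ?N (u @ c # d # v')) s - lin_ext (\<lambda>c. ?N (u @ d # c # v')) s =
        lin_ext ?f (br s d)" for d s
      unfolding lin_ext_fun_diff[symmetric] comm
      by (rule lin_ext_comp) (simp_all add: br_add_left br_scale_left)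
    have J: "br (br x y) z + br (br y z) x - br (br x z) y = 0"
      using jacobi[of z x y] br_anti[of z "br x y"] br_anti[of x "br y z"] br_anti[of y "br z x"]
        br_anti[of z x]
      by (simp add: br_neg algebra_simps)
    \<comment> \<open>The corrections collected along the two routes differ by exactly this value of
      \<open>?f\<close> on the Jacobi sum.\<close>
    have "lin_ext ?f (br (br x y) z) + lin_ext ?f (br (br y z) x) - lin_ext ?f (br (br x z) y) = 0"
      using arg_cong[OF J, of "lin_ext ?f"] lin_ext_add[of ?f _ "- br (br x z) y"]
      by (simp add: lin_ext_add lin_ext_zero lin_ext_neg)
    then have "straighten b u x y (z # v') = straighten b (u @ [x]) y z v'"
      using e1 e2 e3 e4 c1[of z "br x y"] c1[of x "br y z"] c1[of y "br x z"]
      by (simp add: algebra_simps)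
    then show ?thesis using eqs z_def by simp
  next
    case (Cons r0 m)
    then have eqs: "v = m @ x' # y' # v'" "u' = u @ x # y # m" using r r2 by auto
    have w: "w = u @ x # y # m @ x' # y' # v'" using w1 eqs by simp
    have e1: "?N (u @ y # x # m @ x' # y' # v') = straighten b (u @ y # x # m) x' y' v'"
      using IH[of "u @ y # x # m" x' y' v'] inversions_swap[OF l1, of u v]
        inversions_swap[OF l2, of "u @ y # x # m" v'] by (auto simp: w eqs)
    have e2: "?N (u @ x # y # m @ y' # x' # v') = straighten b u x y (m @ y' # x' # v')"
      using IH[of u x y "m @ y' # x' # v'"] inversions_swap[OF l2, of "u @ x # y # m" v']
        inversions_swap[OF l1, of u "m @ y' # x' # v'"] by (auto simp: w eqs)
    \<comment> \<open>Contracting one pair shortens the word, so the other pair can be straightened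
      inside every correction term.\<close>
    have e3: "?N (u @ c # m @ x' # y' # v') = straighten b (u @ c # m) x' y' v'" for c
      using IH[of "u @ c # m" x' y' v'] by (simp add: w)
    have e4: "?N (u @ x # y # m @ c # v') = straighten b u x y (m @ c # v')" for c
      using IH[of u x y "m @ c # v'"] by (simp add: w)
    \<comment> \<open>What remains are the terms with both pairs contracted, where the order of the
      two basis expansions is immaterial.\<close>
    show ?thesis
      using e1 e2 lin_ext_swap[of "\<lambda>c d. ?N (u @ c # m @ d # v')" "br x' y'" "br x y"]
      by (simp add: eqs e3 e4 lin_ext_fun_add)
  qed
qed

text \<open>The defining equation speaks of one chosen descent. By well-founded induction,
  confluence transfers it to any other.\<close>

lemma normal_coeff_descent:
  "w = u @ x # y # v \<Longrightarrow> lt y x \<Longrightarrow> normal_coeff b w = straighten b u x y v"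
proof (induct w arbitrary: u x y v rule: wf_induct_rule[OF wf_measures[of "[length, inversions]"]])
  case (1 w)
  have IH: "normal_coeff b (u @ x # y # v) = straighten b u x y v"
    if "smaller (u @ x # y # v) w" "smaller (u @ y # x # v) w" for u x y v
  proof (rule normal_coeff_commute_if_descents)
    fix u' x' y' v'
    assume "u' @ x' # y' # v' = u @ x # y # v \<or> u' @ x' # y' # v' = u @ y # x # v" and "lt y' x'"
    moreover from this have "smaller (u' @ x' # y' # v') w" using that by metis
    ultimately show "normal_coeff b (u' @ x' # y' # v') = straighten b u' x' y' v'"
      using 1(1) by metis
  qed
  obtain u' x' y' v' where sd: "some_descent w = (u', x', y', v')" by (cases "some_descent w")
  have ex: "descent w (u, x, y, v)" using 1(2,3) by (simp add: descent_def)
  have w': "w = u' @ x' # y' # v'" "lt y' x'" using some_descentD[OF sd[symmetric] ex] by blast+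
  have "normal_coeff b w = straighten b u' x' y' v'"
    using ex by (subst normal_coeff.simps) (simp add: sd, blast)
  also have "\<dots> = straighten b u x y v"
  proof (cases "length u" "length u'" rule: linorder_cases)
    case less
    then show ?thesis using straighten_confluent[OF IH 1(2,3) w'] by simp
  next
    case equal
    then show ?thesis using 1(2) w' by simp
  next
    case greater
    then show ?thesis using straighten_confluent[OF IH w' 1(2,3)] by simp
  qed
  finally show ?case .
qed

lemma normal_coeff_commute:
  "normal_coeff b (u @ x # y # v) = straighten b u x y v"
  by (rule normal_coeff_commute_if_descents) (rule normal_coeff_descent, auto)

lemma normal_coeff_singleton: "normal_coeff b [x] = (if x = b then 1 else 0)"
  by (subst normal_coeff.simps) (simp add: descent_def)

end

section \<open>Multilinear extension from basis words to all words\<close>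

context lie_algebra
begin

text \<open>\<open>normal_coeff\<close> is not additive in its letters. Keeping only its values on
  basis words and extending linearly in each letter makes it so, which is what kills the relations
  \<open>gen_add\<close> and \<open>gen_scale\<close>.\<close>

primrec multi_ext :: "('g list \<Rightarrow> 'f) \<Rightarrow> 'g list \<Rightarrow> 'f" where
  "multi_ext h [] = h []"
| "multi_ext h (x # xs) = lin_ext (\<lambda>c. multi_ext (\<lambda>w. h (c # w)) xs) x"

lemma multi_ext_fun_add: "multi_ext (\<lambda>w. h w + k w) xs = multi_ext h xs + multi_ext k xs"
  by (induct xs arbitrary: h k) (simp_all add: lin_ext_fun_add)

lemma multi_ext_lin_ext:
  "multi_ext (\<lambda>w. lin_ext (\<lambda>c. h c w) z) xs = lin_ext (\<lambda>c. multi_ext (h c) xs) z"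
  by (induct xs arbitrary: h) (simp_all, subst lin_ext_swap, simp)

lemma multi_ext_add:
  "multi_ext h (u @ (x + y) # v) = multi_ext h (u @ x # v) + multi_ext h (u @ y # v)"
  by (induct u arbitrary: h) (simp_all add: lin_ext_add lin_ext_fun_add)

lemma multi_ext_scale: "multi_ext h (u @ scl r x # v) = r * multi_ext h (u @ x # v)"
proof (induct u arbitrary: h)
  case (Cons c u)
  then show ?case by (simp add: lin_ext_def sum_distrib_left mult.left_commute)
qed (simp add: lin_ext_scale)

lemma lin_ext_lin_ext_br:
  "lin_ext (\<lambda>c. lin_ext (\<lambda>d. lin_ext f (br c d)) y) x = lin_ext f (br x y)"
  by (simp add: lin_ext_comp br_add_left br_scale_left br_add_right br_scale_right)

text \<open>On basis letters this is the assumption. It survives the extension because expanding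
  \<open>x\<close> and \<open>y\<close> first and bracketing afterwards gives the same value as
  expanding \<open>br x y\<close> (\<open>lin_ext_lin_ext_br\<close>).\<close>

lemma multi_ext_commute:
  assumes "\<And>u x y v. h (u @ x # y # v) = h (u @ y # x # v) + lin_ext (\<lambda>c. h (u @ c # v)) (br x y)"
  shows "multi_ext h (u @ x # y # v) = multi_ext h (u @ y # x # v) + multi_ext h (u @ br x y # v)"
  using assms
proof (induct u arbitrary: h)
  case Nil
  have swap: "multi_ext (\<lambda>w. h (c # d # w)) v =
      multi_ext (\<lambda>w. h (d # c # w)) v + lin_ext (\<lambda>e. multi_ext (\<lambda>w. h (e # w)) v) (br c d)" for c d
    using Nil[of "[]" c d] by (simp add: multi_ext_fun_add multi_ext_lin_ext)
  have "multi_ext h (x # y # v) = lin_ext (\<lambda>c. lin_ext (\<lambda>d. multi_ext (\<lambda>w. h (d # c # w)) v) y) x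
      + lin_ext (\<lambda>e. multi_ext (\<lambda>w. h (e # w)) v) (br x y)"
    by (simp only: multi_ext.simps) (subst swap, simp only: lin_ext_fun_add lin_ext_lin_ext_br)
  then show ?case by (simp add: lin_ext_swap[of _ x y])
next
  case (Cons a u)
  have "multi_ext (\<lambda>w. h (c # w)) (u @ x # y # v) = multi_ext (\<lambda>w. h (c # w)) (u @ y # x # v)
      + multi_ext (\<lambda>w. h (c # w)) (u @ br x y # v)" for c
  proof (rule Cons(1))
    fix u x y v
    show "h (c # u @ x # y # v) = h (c # u @ y # x # v) + lin_ext (\<lambda>d. h (c # u @ d # v)) (br x y)"
      using Cons(2)[of "c # u" x y v] by simp
  qed
  then show ?case by (simp add: lin_ext_fun_add)
qed

end

section \<open>Functionals on the free algebra that vanish on the ideal\<close>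

primrec letters :: "'a free_mon \<Rightarrow> 'a list" where
  "letters (Mon xs) = xs"

lemma letters_add: "letters (p + q) = letters p @ letters q"
  by (cases p; cases q) simp

lemma free_alg_induct [case_names single add]:
  assumes "\<And>k c. P (Poly_Mapping.single k c)" "\<And>p q. P p \<Longrightarrow> P q \<Longrightarrow> P (p + q)"
  shows "P p"
proof (induct p rule: update_induct)
  case const
  show ?case using assms(1)[of undefined 0] by simp
next
  case (update f a b)
  have "Poly_Mapping.update a b f = f + Poly_Mapping.single a b"
    by (rule poly_mapping_eqI)
      (use update in \<open>auto simp: lookup_update lookup_add lookup_single when_def in_keys_iff\<close>)
  then show ?case using assms(1) assms(2) update by simp
qed

context lie_algebra
begin

definition word_functional :: "('g list \<Rightarrow> 'f) \<Rightarrow> ('g, 'f) free_alg \<Rightarrow> 'f" where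
  "word_functional h p = (\<Sum>k\<in>Poly_Mapping.keys p. Poly_Mapping.lookup p k * multi_ext h (letters k))"

lemma word_functional_add: "word_functional h (p + q) = word_functional h p + word_functional h q"
  unfolding word_functional_def by (rule setsum_keys_plus_distrib) (simp_all add: ring_distribs)

lemma word_functional_diff: "word_functional h (p - q) = word_functional h p - word_functional h q"
  using word_functional_add[of h "p - q" q] by (simp add: algebra_simps)

lemma word_functional_single:
  "word_functional h (Poly_Mapping.single k c) = c * multi_ext h (letters k)"
  by (simp add: word_functional_def)

text \<open>The outer factors \<open>r\<close> and \<open>q\<close> make the claim stable under the
  two multiplication rules of the ideal. For the generating relations they may be taken to be
  monomials, by additivity.\<close>

lemma word_functional_uea_ideal:
  assumes comm: "\<And>u x y v. h (u @ x # y # v) =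
      h (u @ y # x # v) + lin_ext (\<lambda>c. h (u @ c # v)) (br x y)"
    and "p \<in> uea_ideal scl br"
  shows "word_functional h (r * p * q) = 0"
  using assms(2)
proof (induct arbitrary: r q)
  case (gen_add x y)
  show ?case
  proof (induct r rule: free_alg_induct)
    case (single k c)
    show ?case
    proof (induct q rule: free_alg_induct)
      case (single l d)
      show ?case
        by (simp add: gen_def right_diff_distrib left_diff_distrib distrib_left distrib_right
            mult_single word_functional_diff word_functional_add word_functional_single
            letters_add multi_ext_add)
    qed (simp add: distrib_left word_functional_add)
  qed (simp add: distrib_right word_functional_add)
next
  case (gen_scale s x)
  show ?case
  proof (induct r rule: free_alg_induct)
    case (single k c)
    show ?case
    proof (induct q rule: free_alg_induct)
      case (single l d)
      show ?case
        by (simp add: gen_def scalar_def right_diff_distrib left_diff_distrib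
            mult_single word_functional_diff word_functional_single
            letters_add multi_ext_scale)
    qed (simp add: distrib_left word_functional_add)
  qed (simp add: distrib_right word_functional_add)
next
  case (gen_bracket x y)
  show ?case
  proof (induct r rule: free_alg_induct)
    case (single k c)
    show ?case
    proof (induct q rule: free_alg_induct)
      case (single l d)
      show ?case
        by (simp add: gen_def right_diff_distrib left_diff_distrib
            mult_single word_functional_diff word_functional_single
            letters_add multi_ext_commute[OF comm, of "letters k" x y "letters l"] distrib_left)
    qed (simp add: distrib_left word_functional_add)
  qed (simp add: distrib_right word_functional_add)
next
  case (add p q r q')
  then show ?case by (simp add: distrib_left distrib_right word_functional_add)
next
  case (mult_left p r r' q)
  then show ?case using mult_left(2)[of "r' * r" q] by (simp add: mult.assoc)
next
  case (mult_right p r r' q)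
  then show ?case using mult_right(2)[of r' "r * q"] by (simp add: mult.assoc)
qed

text \<open>For each \<open>b\<close>, the functional built from \<open>normal_coeff b\<close>
  vanishes on the ideal and reads off the coordinate of \<open>z\<close> at \<open>b\<close>. Any
  total order on the letters serves, so a well-order of the whole carrier is taken.\<close>

theorem gen_in_uea_ideal:
  assumes "gen z \<in> uea_ideal scl br"
  shows "z = 0"
proof -
  obtain R :: "'g rel" where R: "well_order_on UNIV R" using well_order_on by blast
  define lt where "lt x y \<longleftrightarrow> x \<noteq> y \<and> (x, y) \<in> R" for x y
  interpret ordered_lie_algebra scl br lt
  proof
    have "antisym R" "trans R" "total R"
      using R by (auto simp: well_order_on_def linear_order_on_def partial_order_on_def
          preorder_on_def)
    then show "\<not> lt x x" "lt x y \<Longrightarrow> lt y z \<Longrightarrow> lt x z" "lt x y \<or> x = y \<or> lt y x" for x y z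
      by (auto simp: lt_def total_on_def dest: antisymD transD)
  qed
  have "coord z b = 0" for b
  proof -
    have "word_functional (normal_coeff b) (1 * gen z * 1) = 0"
      by (rule word_functional_uea_ideal[OF normal_coeff_commute assms])
    then have "lin_ext (\<lambda>c. if c = b then 1 else 0) z = 0"
      by (simp add: gen_def word_functional_single normal_coeff_singleton)
    then show ?thesis
      by (auto simp: lin_ext_def if_distrib sum.delta[OF finite_coord] cong: if_cong split: if_splits)
  qed
  then show ?thesis using sum_coord[of z] by simp
qed

end

section \<open>Exponentials in filtered algebras\<close>

definition commutator :: "'r::ring \<Rightarrow> 'r \<Rightarrow> 'r" where
  "commutator x y = x * y - y * x"

lemma sum_atMost_reflect:
  fixes f :: "nat \<Rightarrow> nat \<Rightarrow> 'a::comm_monoid_add"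
  shows "(\<Sum>i\<le>n. f (n - i) i) = (\<Sum>i\<le>n. f i (n - i))"
  by (rule sum.reindex_bij_witness[of _ "\<lambda>i. n - i" "\<lambda>i. n - i"]) auto

lemma sum_choose_Suc:
  fixes f :: "nat \<Rightarrow> 'r::ring_1"
  shows "(\<Sum>r\<le>n. of_nat (n choose r) * (f (Suc r) + f r)) = (\<Sum>r\<le>Suc n. of_nat (Suc n choose r) * f r)"
proof -
  have "(\<Sum>r\<le>Suc n. of_nat (Suc n choose r) * f r) =
      f 0 + (\<Sum>r\<le>n. of_nat (Suc n choose Suc r) * f (Suc r))"
    by (subst sum.atMost_Suc_shift) simp
  also have "\<dots> = (\<Sum>r\<le>n. of_nat (n choose r) * f (Suc r))
      + (f 0 + (\<Sum>r\<le>n. of_nat (n choose Suc r) * f (Suc r)))"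
    by (simp add: distrib_right sum.distrib add_ac)
  also have "f 0 + (\<Sum>r\<le>n. of_nat (n choose Suc r) * f (Suc r)) =
      (\<Sum>r\<le>Suc n. of_nat (n choose r) * f r)"
    by (simp only: sum.atMost_Suc_shift[of _ n]) simp
  also have "\<dots> = (\<Sum>r\<le>n. of_nat (n choose r) * f r)"
    by (simp add: binomial_eq_0)
  finally show ?thesis by (simp add: distrib_left sum.distrib)
qed

text \<open>Left multiplication by \<open>A\<close> is \<open>ad A\<close> plus right multiplication
  by \<open>A\<close>. These two operators commute, so its powers obey the binomial theorem.\<close>

lemma power_mult_commutator:
  fixes A Y :: "'r::ring_1"
  shows "A ^ n * Y = (\<Sum>r\<le>n. of_nat (n choose r) * ((commutator A ^^ r) Y * A ^ (n - r)))"
proof (induct n)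
  case (Suc n)
  let ?f = "\<lambda>r. (commutator A ^^ r) Y * A ^ (Suc n - r)"
  have "A * (of_nat (n choose r) * ((commutator A ^^ r) Y * A ^ (n - r)))
      = of_nat (n choose r) * (?f (Suc r) + ?f r)" if "r \<le> n" for r
  proof -
    have "A * (of_nat (n choose r) * ((commutator A ^^ r) Y * A ^ (n - r)))
      = of_nat (n choose r) * (A * (commutator A ^^ r) Y * A ^ (n - r))"
      by (metis mult.assoc mult_of_nat_commute)
    also have "A * (commutator A ^^ r) Y = (commutator A ^^ Suc r) Y + (commutator A ^^ r) Y * A"
      by (simp add: commutator_def)
    also have "\<dots> * A ^ (n - r) = ?f (Suc r) + ?f r"
      using that by (simp add: distrib_right mult.assoc Suc_diff_le)
    finally show ?thesis .
  qed
  then have "A ^ Suc n * Y = (\<Sum>r\<le>n. of_nat (n choose r) * (?f (Suc r) + ?f r))"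
    by (simp add: mult.assoc Suc sum_distrib_left)
  then show ?case by (simp only: sum_choose_Suc[of n ?f])
qed simp

text \<open>Now right multiplication is left multiplication minus \<open>ad A\<close>, whence the
  signs.\<close>

lemma mult_power_commutator:
  fixes A Y :: "'r::ring_1"
  shows "Y * A ^ n =
    (\<Sum>r\<le>n. of_nat (n choose r) * ((- 1) ^ r * (A ^ (n - r) * (commutator A ^^ r) Y)))"
proof (induct n)
  case (Suc n)
  let ?f = "\<lambda>r. (- 1) ^ r * (A ^ (Suc n - r) * (commutator A ^^ r) Y)"
  have "of_nat (n choose r) * ((- 1) ^ r * (A ^ (n - r) * (commutator A ^^ r) Y)) * A
      = of_nat (n choose r) * (?f (Suc r) + ?f r)" if "r \<le> n" for r
  proof -
    have "(commutator A ^^ r) Y * A = A * (commutator A ^^ r) Y - (commutator A ^^ Suc r) Y"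
      by (simp add: commutator_def)
    then have "A ^ (n - r) * (commutator A ^^ r) Y * A =
        A ^ (Suc n - r) * (commutator A ^^ r) Y - A ^ (n - r) * (commutator A ^^ Suc r) Y"
      using that by (simp only: mult.assoc) (simp add: right_diff_distrib mult.assoc Suc_diff_le power_Suc2
          del: power_Suc)
    then have "(- 1) ^ r * (A ^ (n - r) * (commutator A ^^ r) Y) * A = ?f (Suc r) + ?f r"
      by (simp add: mult.assoc right_diff_distrib)
    then show ?thesis by (simp add: mult.assoc)
  qed
  then have "Y * A ^ Suc n = (\<Sum>r\<le>n. of_nat (n choose r) * (?f (Suc r) + ?f r))"
    by (simp add: power_Suc2 mult.assoc[symmetric] Suc sum_distrib_right del: power_Suc)
  then show ?case by (simp only: sum_choose_Suc[of n ?f])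
qed simp

text \<open>The sum is the derivative of \<open>A ^ Suc n\<close> in direction \<open>Y\<close>. Its
  coefficients arise from summing \<open>i choose r\<close> over \<open>i\<close>, the hockey-stick
  identity.\<close>

lemma sum_power_mult_power:
  fixes A Y :: "'r::ring_1"
  shows "(\<Sum>i\<le>n. A ^ i * Y * A ^ (n - i)) =
    (\<Sum>r\<le>n. of_nat (Suc n choose Suc r) * ((commutator A ^^ r) Y * A ^ (n - r)))"
proof -
  have "(\<Sum>i\<le>n. A ^ i * Y * A ^ (n - i)) =
      (\<Sum>i\<le>n. \<Sum>r\<le>n. of_nat (i choose r) * ((commutator A ^^ r) Y * A ^ (n - r)))"
  proof (intro sum.cong refl)
    fix i assume "i \<in> {..n}"
    then have i: "i \<le> n" by simp
    have "A ^ i * Y * A ^ (n - i) =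
        (\<Sum>r\<le>i. of_nat (i choose r) * ((commutator A ^^ r) Y * A ^ (n - r)))"
      unfolding power_mult_commutator sum_distrib_right
      by (intro sum.cong) (use i in \<open>simp_all add: mult.assoc power_add[symmetric]\<close>)
    also have "\<dots> = (\<Sum>r\<le>n. of_nat (i choose r) * ((commutator A ^^ r) Y * A ^ (n - r)))"
      by (rule sum.mono_neutral_left) (use i in \<open>simp_all add: binomial_eq_0\<close>)
    finally show "A ^ i * Y * A ^ (n - i) = \<dots>" .
  qed
  also have "\<dots> = (\<Sum>r\<le>n. of_nat (\<Sum>i\<le>n. i choose r) * ((commutator A ^^ r) Y * A ^ (n - r)))"
    by (subst sum.swap) (simp add: sum_distrib_right)
  finally show ?thesis by (simp only: sum_choose_upper)
qed

lemma sum_power_mult_power':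
  fixes A Y :: "'r::ring_1"
  shows "(\<Sum>i\<le>n. A ^ i * Y * A ^ (n - i)) =
    (\<Sum>r\<le>n. of_nat (Suc n choose Suc r) * ((- 1) ^ r * (A ^ (n - r) * (commutator A ^^ r) Y)))"
proof -
  have "(\<Sum>i\<le>n. A ^ i * Y * A ^ (n - i)) =
      (\<Sum>i\<le>n. A ^ (n - i) * (Y * A ^ i))"
    by (rule sum.reindex_bij_witness[of _ "\<lambda>i. n - i" "\<lambda>i. n - i"]) (auto simp: mult.assoc)
  also have "\<dots> =
      (\<Sum>i\<le>n. \<Sum>r\<le>n. of_nat (i choose r) * ((- 1) ^ r * (A ^ (n - r) * (commutator A ^^ r) Y)))"
  proof (intro sum.cong refl)
    fix i assume "i \<in> {..n}"
    then have i: "i \<le> n" by simp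
    have "A ^ (n - i) * (of_nat (i choose r) * ((- 1) ^ r * (A ^ (i - r) * (commutator A ^^ r) Y))) =
        of_nat (i choose r) * ((- 1) ^ r * (A ^ (n - r) * (commutator A ^^ r) Y))"
      if "r \<le> i" for r
    proof -
      have "A ^ (n - i) * (of_nat (i choose r) * ((- 1) ^ r * (A ^ (i - r) * (commutator A ^^ r) Y))) =
        of_nat (i choose r) * (A ^ (n - i) * ((- 1) ^ r * (A ^ (i - r) * (commutator A ^^ r) Y)))"
        by (metis mult.assoc mult_of_nat_commute)
      also have "A ^ (n - i) * ((- 1) ^ r * (A ^ (i - r) * (commutator A ^^ r) Y)) =
          (- 1) ^ r * (A ^ (n - i) * A ^ (i - r) * (commutator A ^^ r) Y)"
        by (cases "even r") (simp_all add: mult.assoc)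
      also have "A ^ (n - i) * A ^ (i - r) = A ^ (n - r)"
        using i that by (simp add: power_add[symmetric])
      finally show ?thesis .
    qed
    then have "A ^ (n - i) * (Y * A ^ i) =
        (\<Sum>r\<le>i. of_nat (i choose r) * ((- 1) ^ r * (A ^ (n - r) * (commutator A ^^ r) Y)))"
      unfolding mult_power_commutator sum_distrib_left by (intro sum.cong) simp_all
    also have "\<dots> = (\<Sum>r\<le>n. of_nat (i choose r) * ((- 1) ^ r * (A ^ (n - r) * (commutator A ^^ r) Y)))"
      by (rule sum.mono_neutral_left) (use i in \<open>simp_all add: binomial_eq_0\<close>)
    finally show "A ^ (n - i) * (Y * A ^ i) = \<dots>" .
  qed
  also have "\<dots> = (\<Sum>r\<le>n. of_nat (\<Sum>i\<le>n. i choose r) *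
      ((- 1) ^ r * (A ^ (n - r) * (commutator A ^^ r) Y)))"
    by (subst sum.swap) (simp add: sum_distrib_right)
  finally show ?thesis by (simp only: sum_choose_upper)
qed

section \<open>Truncated exponentials modulo a multiplicative filtration\<close>

locale filtered_algebra =
  fixes F :: "nat \<Rightarrow> 'r::ring_1 set" and Q :: "rat \<Rightarrow> 'r"
  assumes F_0: "F 0 = UNIV"
    and F_antimono: "x \<in> F n \<Longrightarrow> m \<le> n \<Longrightarrow> x \<in> F m"
    and zero_in_F: "0 \<in> F n"
    and F_add: "x \<in> F n \<Longrightarrow> y \<in> F n \<Longrightarrow> x + y \<in> F n"
    and F_mult: "x \<in> F m \<Longrightarrow> y \<in> F n \<Longrightarrow> x * y \<in> F (m + n)"
    and Q_add: "Q (c + d) = Q c + Q d"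
    and Q_mult: "Q (c * d) = Q c * Q d"
    and Q_1: "Q 1 = 1"
    and Q_central: "x * Q c = Q c * x"
begin

lemma F_mult_left: "y \<in> F n \<Longrightarrow> x * y \<in> F n"
  using F_mult[of x 0 y n] F_0 by simp

lemma F_mult_right: "x \<in> F n \<Longrightarrow> x * y \<in> F n"
  using F_mult[of x n y 0] F_0 by simp

lemma F_neg: "x \<in> F n \<Longrightarrow> - x \<in> F n"
  using F_mult_left[of x n "- 1"] by simp

lemma F_diff: "x \<in> F n \<Longrightarrow> y \<in> F n \<Longrightarrow> x - y \<in> F n"
  using F_add[OF _ F_neg, of x n y] by simp

lemma F_sum: "(\<And>i. i \<in> I \<Longrightarrow> f i \<in> F n) \<Longrightarrow> sum f I \<in> F n"
  by (induct I rule: infinite_finite_induct) (auto simp: zero_in_F F_add)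

lemma F_power: "x \<in> F 1 \<Longrightarrow> x ^ n \<in> F n"
proof (induct n)
  case (Suc n)
  then show ?case using F_mult[of x 1 "x ^ n" n] by simp
qed (simp add: F_0)

lemma F_commutator: "x \<in> F 1 \<Longrightarrow> (commutator x ^^ n) y \<in> F n"
proof (induct n)
  case (Suc n)
  then show ?case
    using F_mult[of x 1 _ n] F_mult[of _ n x 1] by (auto simp: commutator_def intro: F_diff)
qed (simp add: F_0)

lemma Q_0: "Q 0 = 0"
  using Q_add[of 0 0] by simp

lemma Q_neg: "Q (- c) = - Q c"
  using Q_add[of c "- c"] by (simp add: Q_0 eq_neg_iff_add_eq_0 add.commute)

lemma Q_of_nat: "Q (of_nat n) = of_nat n"
  by (induct n) (simp_all add: Q_0 Q_1 Q_add)

lemma Q_pow_neg_1: "Q ((- 1) ^ r) = (- 1) ^ r"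
  by (induct r) (simp_all add: Q_mult Q_1 Q_neg)

definition cong :: "nat \<Rightarrow> 'r \<Rightarrow> 'r \<Rightarrow> bool" where
  "cong n x y \<longleftrightarrow> x - y \<in> F n"

lemma cong_refl [intro]: "cong n x x"
  by (simp add: cong_def zero_in_F)

lemma cong_sym: "cong n x y \<Longrightarrow> cong n y x"
  using F_neg[of "x - y" n] by (simp add: cong_def)

lemma cong_antimono: "cong n x y \<Longrightarrow> m \<le> n \<Longrightarrow> cong m x y"
  unfolding cong_def by (rule F_antimono)

lemma cong_trans [trans]: "cong n x y \<Longrightarrow> cong n y z \<Longrightarrow> cong n x z"
  using F_add[of "x - y" n "y - z"] by (simp add: cong_def)

lemma cong_add: "cong n x y \<Longrightarrow> cong n x' y' \<Longrightarrow> cong n (x + x') (y + y')"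
  using F_add[of "x - y" n "x' - y'"] by (simp add: cong_def algebra_simps)

lemma cong_diff: "cong n x y \<Longrightarrow> cong n x' y' \<Longrightarrow> cong n (x - x') (y - y')"
  using F_diff[of "x - y" n "x' - y'"] by (simp add: cong_def algebra_simps)

lemma cong_mult: "cong n x y \<Longrightarrow> cong n x' y' \<Longrightarrow> cong n (x * x') (y * y')"
  using F_add[OF F_mult_right[of "x - y" n x'] F_mult_left[of "x' - y'" n y]]
  by (simp add: cong_def algebra_simps)

lemma cong_sum: "(\<And>i. i \<in> I \<Longrightarrow> cong n (f i) (g i)) \<Longrightarrow> cong n (sum f I) (sum g I)"
  by (induct I rule: infinite_finite_induct) (auto intro: cong_add)

lemma cong_power: "cong n x y \<Longrightarrow> cong n (x ^ k) (y ^ k)"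
  by (induct k) (auto intro: cong_mult)

lemma cong_commutator: "cong n x y \<Longrightarrow> cong n x' y' \<Longrightarrow> cong n (commutator x x') (commutator y y')"
  unfolding commutator_def by (intro cong_diff cong_mult)

text \<open>The sides differ by the part of the square outside the triangle
  \<open>i + j \<le> N\<close>, and its terms lie in \<open>F (Suc N)\<close>. The exchange and
  derivative formulas for truncated exponentials rest on this.\<close>

lemma cauchy_product_cong:
  assumes f: "\<And>i. f i \<in> F i" and g: "\<And>i. g i \<in> F i"
  shows "cong (Suc N) (\<Sum>n\<le>N. \<Sum>i\<le>n. f i * g (n - i)) ((\<Sum>i\<le>N. f i) * (\<Sum>j\<le>N. g j))"
proof -
  let ?T = "{(i, j). i \<le> N \<and> j \<le> N \<and> i + j \<le> N}"
  have sub: "?T \<subseteq> {..N} \<times> {..N}" by auto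
  have "(\<Sum>n\<le>N. \<Sum>i\<le>n. f i * g (n - i)) = (\<Sum>(i, j)\<in>?T. f i * g j)"
    unfolding sum.Sigma[OF finite_atMost ballI[OF finite_atMost]]
    by (rule sum.reindex_bij_witness[of _ "\<lambda>(i, j). (i + j, i)" "\<lambda>(n, i). (i, n - i)"]) auto
  moreover have "(\<Sum>i\<le>N. f i) * (\<Sum>j\<le>N. g j) = (\<Sum>(i, j)\<in>{..N} \<times> {..N}. f i * g j)"
    by (simp add: sum_product sum.cartesian_product)
  moreover have "(\<Sum>(i, j)\<in>{..N} \<times> {..N} - ?T. f i * g j) \<in> F (Suc N)"
    by (rule F_sum) (auto intro!: F_antimono[OF F_mult[OF f g]])
  ultimately show ?thesis
    by (intro cong_sym[of _ "_ * _"]) (simp add: cong_def sum_diff[OF _ sub])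
qed

definition trunc_exp :: "nat \<Rightarrow> 'r \<Rightarrow> 'r" where
  "trunc_exp N X = (\<Sum>p\<le>N. Q (1 / fact p) * X ^ p)"

definition ad_series :: "(nat \<Rightarrow> rat) \<Rightarrow> nat \<Rightarrow> 'r \<Rightarrow> 'r \<Rightarrow> 'r" where
  "ad_series c N X Y = (\<Sum>p\<le>N. Q (c p) * (commutator X ^^ p) Y)"

lemma trunc_exp_Suc_cong: "X \<in> F 1 \<Longrightarrow> cong (Suc N) (trunc_exp (Suc N) X) (trunc_exp N X)"
  using F_mult_left[OF F_power[of X "Suc N"]] by (simp add: trunc_exp_def cong_def)

lemma trunc_exp_cong_1: "X \<in> F 1 \<Longrightarrow> cong 1 (trunc_exp N X) 1"
proof (induct N)
  case (Suc N)
  then show ?case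
    using cong_trans[OF cong_antimono[OF trunc_exp_Suc_cong[of X N], of 1]] by simp
qed (simp add: trunc_exp_def Q_1 cong_refl)

lemma trunc_exp_cong: "cong n X Y \<Longrightarrow> cong n (trunc_exp N X) (trunc_exp N Y)"
  unfolding trunc_exp_def by (intro cong_sum cong_mult cong_refl cong_power)

lemma ad_series_cong: "cong n Y Y' \<Longrightarrow> cong n (ad_series c N X Y) (ad_series c N X Y')"
proof -
  assume "cong n Y Y'"
  then have "cong n ((commutator X ^^ p) Y) ((commutator X ^^ p) Y')" for p
    by (induct p) (auto intro: cong_commutator)
  then show ?thesis
    unfolding ad_series_def by (intro cong_sum cong_mult cong_refl)
qed

lemma Q_choose:
  assumes "r \<le> n"
  shows "Q (1 / fact n) * of_nat (n choose r) = Q (1 / fact r) * Q (1 / fact (n - r))"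
  using assms
  by (simp add: Q_of_nat[symmetric] Q_mult[symmetric] binomial_fact field_simps)

lemma Q_choose_Suc:
  assumes "r \<le> n"
  shows "Q (1 / fact (Suc n)) * of_nat (Suc n choose Suc r) =
    Q (1 / fact (Suc r)) * Q (1 / fact (n - r))"
  using Q_choose[of "Suc r" "Suc n"] assms by simp

lemma Q_mult_mult:
  assumes "q = Q a * Q b"
  shows "q * (x * y) = (Q a * x) * (Q b * y)"
proof -
  have "q * (x * y) = Q a * (Q b * x) * y" by (simp add: assms mult.assoc)
  then show ?thesis by (simp only: Q_central[symmetric, of b] mult.assoc)
qed

text \<open>Dividing the binomial formula for \<open>X ^ n * Y\<close> by n! turns it into a Cauchy
  product; the result is the truncated form of e^X Y = (e^(ad X) Y) e^X.\<close>

lemma trunc_exp_mult: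
  assumes X: "X \<in> F 1"
  shows "cong (Suc N) (trunc_exp N X * Y) (ad_series (\<lambda>p. 1 / fact p) N X Y * trunc_exp N X)"
proof -
  have "trunc_exp N X * Y = (\<Sum>n\<le>N. \<Sum>r\<le>n.
      (Q (1 / fact r) * (commutator X ^^ r) Y) * (Q (1 / fact (n - r)) * X ^ (n - r)))"
    unfolding trunc_exp_def sum_distrib_right mult.assoc power_mult_commutator sum_distrib_left
  proof (intro sum.cong refl)
    fix n r :: nat assume "r \<in> {..n}"
    then have "Q (1 / fact n) * of_nat (n choose r) = Q (1 / fact r) * Q (1 / fact (n - r))"
      by (simp add: Q_choose)
    from Q_mult_mult[OF this]
    show "Q (1 / fact n) * (of_nat (n choose r) * ((commutator X ^^ r) Y * X ^ (n - r))) =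
        Q (1 / fact r) * ((commutator X ^^ r) Y * (Q (1 / fact (n - r)) * X ^ (n - r)))"
      by (simp add: mult.assoc)
  qed
  then show ?thesis
    using cauchy_product_cong[where N = N and f = "\<lambda>r. Q (1 / fact r) * (commutator X ^^ r) Y"
          and g = "\<lambda>r. Q (1 / fact r) * X ^ r",
          OF F_mult_left F_mult_left, OF F_commutator[OF X] F_power[OF X]]
    by (simp only: trunc_exp_def ad_series_def)
qed

text \<open>The mirror image: Y e^X = e^X (e^(- ad X) Y).\<close>

lemma mult_trunc_exp:
  assumes X: "X \<in> F 1"
  shows "cong (Suc N) (Y * trunc_exp N X) (trunc_exp N X * ad_series (\<lambda>p. (- 1) ^ p / fact p) N X Y)"
proof -
  have "Y * trunc_exp N X = (\<Sum>n\<le>N. \<Sum>r\<le>n.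
      (Q (1 / fact (n - r)) * X ^ (n - r)) * (Q ((- 1) ^ r / fact r) * (commutator X ^^ r) Y))"
    unfolding trunc_exp_def sum_distrib_left
  proof (rule sum.cong[OF refl])
    fix n
    have "Y * (Q (1 / fact n) * X ^ n) = Q (1 / fact n) * (Y * X ^ n)"
      by (simp only: mult.assoc[symmetric] Q_central)
    also have "\<dots> = (\<Sum>r\<le>n. Q (1 / fact n) *
        (of_nat (n choose r) * ((- 1) ^ r * (X ^ (n - r) * (commutator X ^^ r) Y))))"
      by (simp only: mult_power_commutator sum_distrib_left)
    also have "\<dots> = (\<Sum>r\<le>n.
      (Q (1 / fact (n - r)) * X ^ (n - r)) * (Q ((- 1) ^ r / fact r) * (commutator X ^^ r) Y))"
    proof (intro sum.cong refl)
      fix r assume "r \<in> {..n}"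
      then have "Q (1 / fact n) * of_nat (n choose r) * (- 1) ^ r =
          Q (1 / fact (n - r)) * Q ((- 1) ^ r / fact r)"
        by (simp add: Q_of_nat[symmetric] Q_pow_neg_1[symmetric] Q_mult[symmetric] binomial_fact mult.commute)
      from Q_mult_mult[OF this]
      show "Q (1 / fact n) * (of_nat (n choose r) * ((- 1) ^ r *
          (X ^ (n - r) * (commutator X ^^ r) Y))) =
          (Q (1 / fact (n - r)) * X ^ (n - r)) * (Q ((- 1) ^ r / fact r) * (commutator X ^^ r) Y)"
        by (simp add: mult.assoc)
    qed
    finally show "Y * (Q (1 / fact n) * X ^ n) = \<dots>" .
  qed
  also have "\<dots> = (\<Sum>n\<le>N. \<Sum>q\<le>n.
      (Q (1 / fact q) * X ^ q) * (Q ((- 1) ^ (n - q) / fact (n - q)) * (commutator X ^^ (n - q)) Y))"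
    by (rule sum.cong[OF refl], rule sum_atMost_reflect)
  finally show ?thesis
    using cauchy_product_cong[where N = N and f = "\<lambda>r. Q (1 / fact r) * X ^ r"
          and g = "\<lambda>r. Q ((- 1) ^ r / fact r) * (commutator X ^^ r) Y",
          OF F_mult_left F_mult_left, OF F_power[OF X] F_commutator[OF X]]
    by (simp only: trunc_exp_def ad_series_def)
qed

end

section \<open>Derivations and linear differential equations\<close>

locale filtered_diff_algebra = filtered_algebra F Q
  for F :: "nat \<Rightarrow> 'r::ring_1 set" and Q :: "rat \<Rightarrow> 'r" +
  fixes D :: "'r \<Rightarrow> 'r"
  assumes D_add: "D (x + y) = D x + D y"
    and D_mult: "D (x * y) = x * D y + D x * y"
    and D_Q: "D (Q c) = 0"
    and D_lift: "x \<in> F (Suc n) \<Longrightarrow> D x \<in> F (Suc n) \<Longrightarrow> x \<in> F (Suc (Suc n))"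
begin

lemma D_0: "D 0 = 0"
  using D_add[of 0 0] by simp

lemma D_diff: "D (x - y) = D x - D y"
  using D_add[of "x - y" y] by simp

lemma D_sum: "D (sum f I) = (\<Sum>i\<in>I. D (f i))"
  by (induct I rule: infinite_finite_induct) (simp_all add: D_0 D_add)

lemma D_power: "D (x ^ Suc n) = (\<Sum>i\<le>n. x ^ i * D x * x ^ (n - i))"
proof (induct n)
  case (Suc n)
  have "D (x ^ Suc (Suc n)) = x * D (x ^ Suc n) + D x * x ^ Suc n"
    by (simp only: power_Suc[of x "Suc n"] D_mult)
  also have "x * D (x ^ Suc n) = (\<Sum>i\<le>n. x ^ Suc i * D x * x ^ (n - i))"
    by (simp add: Suc sum_distrib_left mult.assoc del: power_Suc) (simp add: mult.assoc)
  also have "\<dots> + D x * x ^ Suc n = (\<Sum>i\<le>Suc n. x ^ i * D x * x ^ (Suc n - i))"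
    by (subst sum.atMost_Suc_shift) simp
  finally show ?case .
qed simp

lemma D_trunc_exp:
  "D (trunc_exp (Suc N) X) = (\<Sum>n\<le>N. Q (1 / fact (Suc n)) * (\<Sum>i\<le>n. X ^ i * D X * X ^ (n - i)))"
proof -
  have "D 1 = 0" using D_Q[of 1] by (simp add: Q_1)
  then show ?thesis
    unfolding trunc_exp_def by (subst sum.atMost_Suc_shift)
      (simp add: D_add D_sum D_mult D_Q D_power Q_1 del: power_Suc fact_Suc)
qed

text \<open>The coefficients are those of \<phi>(z) = (e^z - 1) / z, applied to \<open>ad X\<close>.
  Differentiation lowers powers by one, so the truncation drops from \<open>Suc N\<close> to
  \<open>N\<close>.\<close>

lemma D_trunc_exp_left:
  assumes X: "X \<in> F 1"
  shows "cong (Suc N) (D (trunc_exp (Suc N) X))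
    (ad_series (\<lambda>p. 1 / fact (Suc p)) N X (D X) * trunc_exp N X)"
proof -
  have "D (trunc_exp (Suc N) X) = (\<Sum>n\<le>N. \<Sum>r\<le>n.
      (Q (1 / fact (Suc r)) * (commutator X ^^ r) (D X)) * (Q (1 / fact (n - r)) * X ^ (n - r)))"
    unfolding D_trunc_exp sum_power_mult_power sum_distrib_left
  proof (intro sum.cong refl)
    fix n r :: nat assume "r \<in> {..n}"
    then have "Q (1 / fact (Suc n)) * of_nat (Suc n choose Suc r) =
        Q (1 / fact (Suc r)) * Q (1 / fact (n - r))"
      using Q_choose_Suc by simp
    from Q_mult_mult[OF this] show "Q (1 / fact (Suc n)) *
          (of_nat (Suc n choose Suc r) * ((commutator X ^^ r) (D X) * X ^ (n - r))) =
        Q (1 / fact (Suc r)) * (commutator X ^^ r) (D X) * (Q (1 / fact (n - r)) * X ^ (n - r))"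
      by (simp add: mult.assoc del: fact_Suc binomial_Suc_Suc)
  qed
  then show ?thesis
    using cauchy_product_cong[where N = N and f = "\<lambda>r. Q (1 / fact (Suc r)) * (commutator X ^^ r) (D X)"
          and g = "\<lambda>r. Q (1 / fact r) * X ^ r",
          OF F_mult_left F_mult_left, OF F_commutator[OF X] F_power[OF X]]
    by (simp only: trunc_exp_def ad_series_def)
qed

text \<open>With the factor from \<open>D X\<close> on the right of the exponential, \<phi>(z)
  becomes \<phi>(- z).\<close>

lemma D_trunc_exp_right:
  assumes X: "X \<in> F 1"
  shows "cong (Suc N) (D (trunc_exp (Suc N) X))
    (trunc_exp N X * ad_series (\<lambda>p. (- 1) ^ p / fact (Suc p)) N X (D X))"
proof -
  have "D (trunc_exp (Suc N) X) = (\<Sum>n\<le>N. \<Sum>r\<le>n.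
      (Q (1 / fact (n - r)) * X ^ (n - r)) *
      (Q ((- 1) ^ r / fact (Suc r)) * (commutator X ^^ r) (D X)))"
    unfolding D_trunc_exp sum_power_mult_power' sum_distrib_left
  proof (intro sum.cong refl)
    fix n r :: nat assume "r \<in> {..n}"
    then have "Q (1 / fact (Suc n)) * of_nat (Suc n choose Suc r) * (- 1) ^ r =
        Q (1 / fact (n - r)) * Q ((- 1) ^ r / fact (Suc r))"
      by (simp add: Q_of_nat[symmetric] Q_pow_neg_1[symmetric] Q_mult[symmetric] binomial_fact mult.commute
          del: fact_Suc binomial_Suc_Suc)
    from Q_mult_mult[OF this] show "Q (1 / fact (Suc n)) * (of_nat (Suc n choose Suc r) *
          ((- 1) ^ r * (X ^ (n - r) * (commutator X ^^ r) (D X)))) =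
        Q (1 / fact (n - r)) * X ^ (n - r) *
          (Q ((- 1) ^ r / fact (Suc r)) * (commutator X ^^ r) (D X))"
      by (simp add: mult.assoc del: fact_Suc binomial_Suc_Suc)
  qed
  also have "\<dots> = (\<Sum>n\<le>N. \<Sum>q\<le>n.
      (Q (1 / fact q) * X ^ q) *
      (Q ((- 1) ^ (n - q) / fact (Suc (n - q))) * (commutator X ^^ (n - q)) (D X)))"
    by (rule sum.cong[OF refl], rule sum_atMost_reflect)
  finally show ?thesis
    using cauchy_product_cong[where N = N and f = "\<lambda>r. Q (1 / fact r) * X ^ r"
          and g = "\<lambda>r. Q ((- 1) ^ r / fact (Suc r)) * (commutator X ^^ r) (D X)",
          OF F_mult_left F_mult_left, OF F_power[OF X] F_commutator[OF X]]
    by (simp only: trunc_exp_def ad_series_def)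
qed

text \<open>\<open>D_lift\<close> is integration: if \<open>Z\<close> vanishes to some order, so
  does its derivative, and \<open>Z\<close> gains one order. The initial condition
  \<open>Z \<in> F 1\<close> must be assumed, since constants have derivative zero.\<close>

lemma linear_ode_unique:
  assumes "Z \<in> F 1" "cong n (D Z) (c * Z)"
  shows "Z \<in> F (Suc n)"
proof -
  have "m \<le> n \<Longrightarrow> Z \<in> F (Suc m)" for m
  proof (induct m)
    case (Suc m)
    then have Z: "Z \<in> F (Suc m)" by simp
    have "D Z - c * Z \<in> F (Suc m)" using cong_antimono[OF assms(2)] Suc by (simp add: cong_def)
    then have "D Z \<in> F (Suc m)" using F_add[OF _ F_mult_left[OF Z, of c]] by fastforce
    then show ?case using D_lift Z by blast
  qed (use assms in simp)
  then show ?thesis by simp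
qed

lemma ad_series_commuting:
  assumes "commutator X Y = 0"
  shows "ad_series c N X Y = Q (c 0) * Y"
proof -
  have "(commutator X ^^ Suc p) Y = 0" for p
    by (induct p) (use assms in \<open>simp_all add: commutator_def\<close>)
  then show ?thesis
    unfolding ad_series_def by (subst sum.atMost_shift) (simp del: funpow.simps)
qed

text \<open>
  Both products solve \<open>Z' = c Z\<close>.
\<close>

theorem trunc_exp_factorization:
  assumes F1: "A \<in> F 1" "B \<in> F 1" "X \<in> F 1" "Y \<in> F 1"
    and comm: "commutator X (D X) = 0" "commutator Y (D Y) = 0"
    and c: "cong (Suc N) c (D X + ad_series (\<lambda>p. 1 / fact p) N X (D Y))"
    and AB: "cong (Suc N)
        (ad_series (\<lambda>p. (- 1) ^ p / fact (Suc p)) N A (D A)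
          + ad_series (\<lambda>p. 1 / fact (Suc p)) N B (D B))
        (ad_series (\<lambda>p. (- 1) ^ p / fact p) N A c)"
  shows "cong (Suc (Suc N))
    (trunc_exp (Suc N) X * trunc_exp (Suc N) Y) (trunc_exp (Suc N) A * trunc_exp (Suc N) B)"
proof -
  let ?e = "trunc_exp (Suc N)" and ?e' = "trunc_exp N"
  let ?XY = "?e X * ?e Y" and ?AB = "?e A * ?e B"
  have tr: "cong (Suc N) (?e Z) (?e' Z)" "cong (Suc N) (?e' Z) (?e Z)" if "Z \<in> F 1" for Z
    using trunc_exp_Suc_cong[OF that] cong_sym by blast+
  have dX: "cong (Suc N) (D (?e X)) (D X * ?e' X)"
    and dY: "cong (Suc N) (D (?e Y)) (D Y * ?e' Y)"
    using D_trunc_exp_left[of X N] D_trunc_exp_left[of Y N] F1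
    by (simp_all add: ad_series_commuting[OF comm(1)] ad_series_commuting[OF comm(2)] Q_1)
  \<comment> \<open>Carrying \<open>D Y\<close> leftwards past the exponential of \<open>X\<close>
    applies e^(ad X) to it. Then both terms of the product rule have their coefficient in
    front.\<close>
  have "cong (Suc N) (D ?XY) (?e' X * (D Y * ?e' Y) + (D X * ?e' X) * ?e' Y)"
    unfolding D_mult using dX dY tr F1 by (intro cong_add cong_mult) auto
  also have "\<dots> = (?e' X * D Y) * ?e' Y + D X * ?e' X * ?e' Y"
    by (simp add: mult.assoc)
  also have "cong (Suc N) \<dots>
      ((ad_series (\<lambda>p. 1 / fact p) N X (D Y) * ?e' X) * ?e' Y + D X * ?e' X * ?e' Y)"
    using F1 by (intro cong_add cong_mult cong_refl trunc_exp_mult)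
  also have "\<dots> = (D X + ad_series (\<lambda>p. 1 / fact p) N X (D Y)) * (?e' X * ?e' Y)"
    by (simp add: algebra_simps)
  also have "cong (Suc N) \<dots> (c * ?XY)"
    using c tr F1 by (intro cong_mult) (auto intro: cong_sym)
  finally have XY: "cong (Suc N) (D ?XY) (c * ?XY)" .
  \<comment> \<open>The derivative of the left factor is written on its right and that of the right
    factor on its left. Both meet between the exponentials, where \<open>AB\<close> applies.\<close>
  have "cong (Suc N) (D ?AB)
     (?e' A * (ad_series (\<lambda>p. 1 / fact (Suc p)) N B (D B) * ?e' B)
      + (?e' A * ad_series (\<lambda>p. (- 1) ^ p / fact (Suc p)) N A (D A)) * ?e' B)"
    unfolding D_mult using tr F1
    by (intro cong_add cong_mult D_trunc_exp_left D_trunc_exp_right) auto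
  also have "\<dots> = ?e' A * (ad_series (\<lambda>p. (- 1) ^ p / fact (Suc p)) N A (D A)
      + ad_series (\<lambda>p. 1 / fact (Suc p)) N B (D B)) * ?e' B"
    by (simp add: algebra_simps)
  also have "cong (Suc N) \<dots> (?e' A * ad_series (\<lambda>p. (- 1) ^ p / fact p) N A c * ?e' B)"
    by (intro cong_mult cong_refl AB)
  \<comment> \<open>Passing the exponential of \<open>A\<close> back across undoes e^(- ad A) and
    brings \<open>c\<close> to the front.\<close>
  also have "cong (Suc N) \<dots> (c * ?e' A * ?e' B)"
    using F1 by (intro cong_mult cong_refl cong_sym[OF mult_trunc_exp])
  also have "\<dots> = c * (?e' A * ?e' B)"
    by (simp add: mult.assoc)
  also have "cong (Suc N) \<dots> (c * ?AB)"
    using tr F1 by (intro cong_mult cong_refl) auto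
  finally have "cong (Suc N) (D ?AB) (c * ?AB)" .
  from cong_diff[OF XY this] have ode: "cong (Suc N) (D (?XY - ?AB)) (c * (?XY - ?AB))"
    by (simp add: D_diff algebra_simps)
  \<comment> \<open>Initial condition: all four exponentials are 1 modulo
    \<open>F 1\<close>.\<close>
  have "cong 1 ?XY (1 * 1)"
    using F1 by (intro cong_mult trunc_exp_cong_1)
  moreover have "cong 1 (1 * 1) ?AB"
    using F1 by (intro cong_sym[of _ "_ * _" "1 * 1"] cong_mult trunc_exp_cong_1)
  ultimately have "cong 1 ?XY ?AB" using cong_trans by blast
  then have "?XY - ?AB \<in> F 1" by (simp add: cong_def)
  with ode show ?thesis using linear_ode_unique by (simp add: cong_def)
qed

end

section \<open>Exponentials over the enveloping algebra\<close>

lemma ser2_nth [simp]: "ser2 f $ m $ n = f m n"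
  by (simp add: ser2_def)

lemma ser2_eqI: "(\<And>m n. X $ m $ n = Y $ m $ n) \<Longrightarrow> X = Y"
  by (simp add: fps_eq_iff)

lemma fps_fps_mult_nth:
  fixes X Y :: "'a::semiring_0 fps fps"
  shows "(X * Y) $ m $ n = (\<Sum>i\<le>m. \<Sum>j\<le>n. X $ i $ j * Y $ (m - i) $ (n - j))"
  by (simp add: fps_mult_nth fps_sum_nth atLeast0AtMost)

lemma sum_nth_nth: "(\<Sum>k\<in>K. f k) $ m $ n = (\<Sum>k\<in>K. f k $ m $ n)"
  by (simp add: fps_sum_nth)

lemma scalar_add: "scalar (c + d) = scalar c + scalar d"
  by (simp add: scalar_def single_add)

lemma scalar_mult: "scalar (c * d) = scalar c * scalar d"
  by (simp add: scalar_def mult_single)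

lemma scalar_1: "scalar 1 = 1"
  by (simp add: scalar_def)

lemma scalar_central: "p * scalar c = scalar c * p"
  by (induct p rule: free_alg_induct)
    (simp_all add: scalar_def mult_single mult.commute distrib_left distrib_right)

definition rat_scalar :: "rat \<Rightarrow> ('g, 'f::field_char_0) free_alg fps fps" where
  "rat_scalar c = fps_const (fps_const (scalar (of_rat c)))"

lemma rat_scalar_mult_nth: "(rat_scalar c * X) $ m $ n = scalar (of_rat c) * X $ m $ n"
  by (simp add: rat_scalar_def)

lemma rat_scalar_central: "X * rat_scalar c = rat_scalar c * X"
  by (rule ser2_eqI) (simp add: rat_scalar_def scalar_central)

context lie_algebra
begin

abbreviation UI :: "('g, 'f) free_alg set" where
  "UI \<equiv> uea_ideal scl br"

lemma UI_zero: "0 \<in> UI"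
  using uea_ideal.mult_left[OF uea_ideal.gen_add, of 0 _ _ scl br] by simp

lemma UI_neg: "p \<in> UI \<Longrightarrow> - p \<in> UI"
  using uea_ideal.mult_left[of p scl br "- 1"] by simp

lemma UI_diff: "p \<in> UI \<Longrightarrow> q \<in> UI \<Longrightarrow> p - q \<in> UI"
  using uea_ideal.add[OF _ UI_neg, of p q] by simp

lemma UI_sum: "(\<And>i. i \<in> K \<Longrightarrow> f i \<in> UI) \<Longrightarrow> sum f K \<in> UI"
  by (induct K rule: infinite_finite_induct) (auto simp: UI_zero uea_ideal.add)

lemma gen_zero: "gen 0 \<in> UI"
  using UI_neg[OF uea_ideal.gen_add[of 0 0 scl br]] by simp

lemma gen_sum: "gen (\<Sum>i\<in>K. f i) - (\<Sum>i\<in>K. gen (f i)) \<in> UI"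
proof (induct K rule: infinite_finite_induct)
  case (insert x K)
  have "gen (\<Sum>i\<in>insert x K. f i) - (\<Sum>i\<in>insert x K. gen (f i)) =
      (gen (f x + sum f K) - (gen (f x) + gen (sum f K))) + (gen (sum f K) - (\<Sum>i\<in>K. gen (f i)))"
    using insert(1,2) by simp
  also have "\<dots> \<in> UI" using insert(3) by (intro uea_ideal.add uea_ideal.gen_add)
  finally show ?case .
qed (simp_all add: gen_zero)

end

section \<open>The degree filtration and the u-adic filtration\<close>

locale lie_algebra_char_0 = lie_algebra scl br
  for scl :: "'f::field_char_0 \<Rightarrow> 'g::ab_group_add \<Rightarrow> 'g" and br :: "'g \<Rightarrow> 'g \<Rightarrow> 'g"
begin

text \<open>
  Low coefficients must lie in the ideal rather than vanish, as \<open>gen 0\<close> is nonzero in the free algebra.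
\<close>

definition deg_ideal :: "nat \<Rightarrow> ('g, 'f) free_alg fps fps set" where
  "deg_ideal n = {X. \<forall>i j. i + j < n \<longrightarrow> X $ i $ j \<in> UI}"

definition coeff_ideal :: "('g, 'f) free_alg fps fps set" where
  "coeff_ideal = {X. \<forall>i j. X $ i $ j \<in> UI}"

sublocale st: filtered_algebra deg_ideal rat_scalar
proof
  fix m n :: nat and x y :: "('g, 'f) free_alg fps fps"
  assume x: "x \<in> deg_ideal m" and y: "y \<in> deg_ideal n"
  show "x * y \<in> deg_ideal (m + n)"
    unfolding deg_ideal_def mem_Collect_eq fps_fps_mult_nth
  proof (intro allI impI UI_sum)
    fix i j k l :: nat
    assume "i + j < m + n" "k \<in> {..i}" "l \<in> {..j}"
    then consider "k + l < m" | "(i - k) + (j - l) < n" by fastforce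
    then show "x $ k $ l * y $ (i - k) $ (j - l) \<in> UI"
      using x y by cases (auto simp: deg_ideal_def intro: uea_ideal.mult_left uea_ideal.mult_right)
  qed
next
  fix c d :: rat
  show "rat_scalar (c + d) = rat_scalar c + (rat_scalar d :: ('g, 'f) free_alg fps fps)"
    and "rat_scalar (c * d) = rat_scalar c * (rat_scalar d :: ('g, 'f) free_alg fps fps)"
    and "rat_scalar 1 = (1 :: ('g, 'f) free_alg fps fps)"
    by (simp_all add: rat_scalar_def of_rat_add of_rat_mult scalar_add scalar_mult scalar_1)
qed (auto simp: deg_ideal_def UI_zero uea_ideal.add rat_scalar_central)

lemma coeff_ideal_zero: "0 \<in> coeff_ideal"
  by (simp add: coeff_ideal_def UI_zero)

lemma coeff_ideal_add: "X \<in> coeff_ideal \<Longrightarrow> Y \<in> coeff_ideal \<Longrightarrow> X + Y \<in> coeff_ideal"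
  by (simp add: coeff_ideal_def uea_ideal.add)

lemma coeff_ideal_diff: "X \<in> coeff_ideal \<Longrightarrow> Y \<in> coeff_ideal \<Longrightarrow> X - Y \<in> coeff_ideal"
  by (simp add: coeff_ideal_def UI_diff)

lemma coeff_ideal_neg: "X \<in> coeff_ideal \<Longrightarrow> - X \<in> coeff_ideal"
  by (simp add: coeff_ideal_def UI_neg)

lemma coeff_ideal_sum: "(\<And>i. i \<in> K \<Longrightarrow> f i \<in> coeff_ideal) \<Longrightarrow> sum f K \<in> coeff_ideal"
  by (induct K rule: infinite_finite_induct) (auto simp: coeff_ideal_zero coeff_ideal_add)

lemma coeff_ideal_mult_left: "Y \<in> coeff_ideal \<Longrightarrow> X * Y \<in> coeff_ideal"
  by (auto simp: coeff_ideal_def fps_fps_mult_nth intro!: UI_sum uea_ideal.mult_left)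

lemma coeff_ideal_mult_right: "X \<in> coeff_ideal \<Longrightarrow> X * Y \<in> coeff_ideal"
  by (auto simp: coeff_ideal_def fps_fps_mult_nth intro!: UI_sum uea_ideal.mult_right)

lemma coeff_ideal_deg_ideal: "X \<in> coeff_ideal \<Longrightarrow> X \<in> deg_ideal n"
  by (simp add: coeff_ideal_def deg_ideal_def)

text \<open>Low powers of u must vanish entirely in the enveloping algebra, in all s,t-degrees; the
  degree filtration plays its part when u is set to 1.\<close>

definition u_ideal :: "nat \<Rightarrow> ('g, 'f) free_alg fps fps fps set" where
  "u_ideal n = {X. \<forall>k<n. X $ k \<in> coeff_ideal}"

sublocale u: filtered_diff_algebra u_ideal "\<lambda>c. fps_const (rat_scalar c)" fps_deriv
proof
  fix m n :: nat and x y :: "('g, 'f) free_alg fps fps fps"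
  assume x: "x \<in> u_ideal m" and y: "y \<in> u_ideal n"
  show "x * y \<in> u_ideal (m + n)"
    unfolding u_ideal_def mem_Collect_eq fps_mult_nth
  proof (intro allI impI coeff_ideal_sum)
    fix k i :: nat
    assume "k < m + n" "i \<in> {0..k}"
    then consider "i < m" | "k - i < n" by fastforce
    then show "x $ i * y $ (k - i) \<in> coeff_ideal"
      using x y by cases (auto simp: u_ideal_def intro: coeff_ideal_mult_left coeff_ideal_mult_right)
  qed
next
  fix n :: nat and x :: "('g, 'f) free_alg fps fps fps"
  assume x: "x \<in> u_ideal (Suc n)" and dx: "fps_deriv x \<in> u_ideal (Suc n)"
  show "x \<in> u_ideal (Suc (Suc n))"
    unfolding u_ideal_def
  proof (intro CollectI allI impI)
    fix k assume k: "k < Suc (Suc n)"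
    show "x $ k \<in> coeff_ideal"
    proof (cases k)
      case 0
      then show ?thesis using x by (simp add: u_ideal_def)
    next
      case (Suc l)
      then have "of_nat (Suc l) * x $ Suc l \<in> coeff_ideal"
        using dx k by (simp add: u_ideal_def del: of_nat_Suc)
      \<comment> \<open>The derivative determines the coefficient only up to the factor
        \<open>Suc l\<close>, which is divided out by a rational scalar.\<close>
      then have "rat_scalar (1 / of_nat (Suc l)) * (of_nat (Suc l) * x $ Suc l) \<in> coeff_ideal"
        by (rule coeff_ideal_mult_left)
      also have "rat_scalar (1 / of_nat (Suc l)) * (of_nat (Suc l) * x $ Suc l) = x $ Suc l"
        unfolding mult.assoc[symmetric] st.Q_of_nat[symmetric] st.Q_mult[symmetric]
        by (simp add: st.Q_1 del: of_nat_Suc)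
      finally show ?thesis by (simp add: Suc)
    qed
  qed
next
  fix c :: rat and x :: "('g, 'f) free_alg fps fps fps"
  show "x * fps_const (rat_scalar c) = fps_const (rat_scalar c) * x"
    by (rule fps_ext) (simp add: rat_scalar_central)
qed (auto simp: u_ideal_def coeff_ideal_zero coeff_ideal_add st.Q_add st.Q_mult st.Q_1)

section \<open>Brackets of series as commutators modulo the ideal\<close>

abbreviation emb :: "'g fps fps \<Rightarrow> ('g, 'f) free_alg fps fps" where
  "emb \<equiv> ser2_gen"

abbreviation rscl :: "rat \<Rightarrow> 'g fps fps \<Rightarrow> 'g fps fps" where
  "rscl c \<equiv> ser2_scl scl (of_rat c)"

definition seq_emb :: "(nat \<Rightarrow> 'g fps fps) \<Rightarrow> ('g, 'f) free_alg fps fps fps" where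
  "seq_emb E = Abs_fps (\<lambda>k. emb (E k))"

lemma emb_add: "emb (X + Y) - (emb X + emb Y) \<in> coeff_ideal"
  by (simp add: coeff_ideal_def ser2_gen_def uea_ideal.gen_add)

lemma emb_zero: "emb 0 \<in> coeff_ideal"
  by (simp add: coeff_ideal_def ser2_gen_def gen_zero)

lemma emb_scale: "emb (rscl c X) - rat_scalar c * emb X \<in> coeff_ideal"
  by (simp add: coeff_ideal_def ser2_gen_def ser2_scl_def rat_scalar_mult_nth uea_ideal.gen_scale)

lemma emb_sum: "emb (\<Sum>i\<in>K. f i) - (\<Sum>i\<in>K. emb (f i)) \<in> coeff_ideal"
  by (simp add: coeff_ideal_def ser2_gen_def sum_nth_nth gen_sum)

text \<open>Coefficientwise a sum of bracket relations. The second product of the commutator is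
  summed with reversed indices so that it involves the same pairs of coefficients as the first, and
  \<open>gen_sum\<close> supplies additivity.\<close>

lemma emb_br: "emb (ser2_br br X Y) - commutator (emb X) (emb Y) \<in> coeff_ideal"
  unfolding coeff_ideal_def
proof (intro CollectI allI)
  fix m n
  let ?x = "\<lambda>i j. X $ i $ j" and ?y = "\<lambda>i j. Y $ (m - i) $ (n - j)"
  have "(emb Y * emb X) $ m $ n = (\<Sum>i\<le>m. \<Sum>j\<le>n. gen (?y i j) * gen (?x i j))"
    unfolding fps_fps_mult_nth ser2_gen_def ser2_nth
    by (subst sum_atMost_reflect[symmetric], rule sum.cong[OF refl],
        subst sum_atMost_reflect[symmetric], rule sum.cong[OF refl]) simp
  then have comm: "commutator (emb X) (emb Y) $ m $ n =
      (\<Sum>i\<le>m. \<Sum>j\<le>n. gen (?x i j) * gen (?y i j) - gen (?y i j) * gen (?x i j))"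
    by (simp add: commutator_def fps_fps_mult_nth[of "emb X"] sum_subtractf)
      (simp add: ser2_gen_def)
  have "(\<Sum>i\<le>m. \<Sum>j\<le>n. gen (br (?x i j) (?y i j))) - commutator (emb X) (emb Y) $ m $ n =
      - (\<Sum>i\<le>m. \<Sum>j\<le>n. gen (?x i j) * gen (?y i j) - gen (?y i j) * gen (?x i j)
          - gen (br (?x i j) (?y i j)))"
    by (simp add: comm sum_subtractf)
  also have "\<dots> \<in> UI"
    by (intro UI_neg UI_sum uea_ideal.gen_bracket)
  finally have 1: "(\<Sum>i\<le>m. \<Sum>j\<le>n. gen (br (?x i j) (?y i j))) -
      commutator (emb X) (emb Y) $ m $ n \<in> UI" .
  have 2: "emb (ser2_br br X Y) $ m $ n - (\<Sum>i\<le>m. \<Sum>j\<le>n. gen (br (?x i j) (?y i j))) \<in> UI"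
    using gen_sum[of "\<lambda>(i, j). br (?x i j) (?y i j)" "{..m} \<times> {..n}"]
    by (simp add: ser2_gen_def ser2_br_def sum.cartesian_product split_def)
  show "(emb (ser2_br br X Y) - commutator (emb X) (emb Y)) $ m $ n \<in> UI"
    using uea_ideal.add[OF 1 2] by simp
qed

lemma u_cong_iff: "u.cong n X Y \<longleftrightarrow> (\<forall>k<n. X $ k - Y $ k \<in> coeff_ideal)"
  by (simp add: u.cong_def u_ideal_def)

text \<open>The bracket of series in u over g[[s,t]], a series being its sequence of coefficients.
  The operations \<open>seq_...\<close> compute inside the Lie algebra and are the values of the
  formal operations \<open>gr_...\<close>.\<close>

definition seq_br :: "(nat \<Rightarrow> 'g fps fps) \<Rightarrow> (nat \<Rightarrow> 'g fps fps) \<Rightarrow> nat \<Rightarrow> 'g fps fps" where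
  "seq_br X Y k = (\<Sum>i\<le>k. ser2_br br (X i) (Y (k - i)))"

definition seq_ad :: "(nat \<Rightarrow> rat) \<Rightarrow> (nat \<Rightarrow> 'g fps fps) \<Rightarrow> (nat \<Rightarrow> 'g fps fps) \<Rightarrow> nat \<Rightarrow> 'g fps fps"
  where "seq_ad c X Y k = (\<Sum>p\<le>k. rscl (c p) ((seq_br X ^^ p) Y k))"

lemma seq_emb_br: "u.cong n (commutator (seq_emb X) (seq_emb Y)) (seq_emb (seq_br X Y))"
  unfolding u_cong_iff
proof (intro allI impI)
  fix k
  have refl: "(seq_emb Y * seq_emb X) $ k = (\<Sum>i\<le>k. emb (Y (k - i)) * emb (X i))"
    unfolding fps_mult_nth atLeast0AtMost seq_emb_def fps_nth_Abs_fps
    by (subst sum_atMost_reflect[symmetric]) simp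
  have "(commutator (seq_emb X) (seq_emb Y)) $ k =
      (\<Sum>i\<le>k. commutator (emb (X i)) (emb (Y (k - i))))"
    unfolding commutator_def fps_sub_nth refl
    by (simp add: fps_mult_nth atLeast0AtMost seq_emb_def sum_subtractf)
  then have "commutator (seq_emb X) (seq_emb Y) $ k - seq_emb (seq_br X Y) $ k =
      - (\<Sum>i\<le>k. emb (ser2_br br (X i) (Y (k - i))) - commutator (emb (X i)) (emb (Y (k - i))))
      - (emb (\<Sum>i\<le>k. ser2_br br (X i) (Y (k - i))) - (\<Sum>i\<le>k. emb (ser2_br br (X i) (Y (k - i)))))"
    by (simp add: seq_emb_def seq_br_def sum_subtractf)
  also have "\<dots> \<in> coeff_ideal"
    by (intro coeff_ideal_diff coeff_ideal_neg coeff_ideal_sum emb_br emb_sum)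
  finally show "commutator (seq_emb X) (seq_emb Y) $ k - seq_emb (seq_br X Y) $ k \<in> coeff_ideal" .
qed

lemma seq_emb_br_funpow:
  "u.cong n ((commutator (seq_emb X) ^^ p) (seq_emb Y)) (seq_emb ((seq_br X ^^ p) Y))"
proof (induct p)
  case (Suc p)
  then show ?case
    using u.cong_trans[OF u.cong_commutator[OF u.cong_refl Suc] seq_emb_br] by simp
qed auto

text \<open>One side stops at \<open>N\<close>, the other at \<open>p = k\<close>. As
  \<open>X 0 = 0\<close>, a p-fold bracket starts in u-degree \<open>p\<close>, so the powers in
  between contribute only elements of the ideal.\<close>

lemma seq_emb_ad:
  assumes "X 0 = 0"
  shows "u.cong (Suc N) (u.ad_series c N (seq_emb X) (seq_emb Y)) (seq_emb (seq_ad c X Y))"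
  unfolding u_cong_iff
proof (intro allI impI)
  fix k assume "k < Suc N"
  then have k: "k \<le> N" by simp
  let ?E = "\<lambda>p. (commutator (seq_emb X) ^^ p) (seq_emb Y)"
  let ?e = "\<lambda>p. (seq_br X ^^ p) Y k"
  have X1: "seq_emb X \<in> u_ideal 1"
    using assms emb_zero by (simp add: u_ideal_def seq_emb_def)
  have tail: "?E p $ k \<in> coeff_ideal" if "k < p" for p
    using u.F_commutator[OF X1, of p "seq_emb Y"] that by (simp add: u_ideal_def)
  have E: "?E p $ k - emb (?e p) \<in> coeff_ideal" for p
    using seq_emb_br_funpow[of "Suc k" p X Y] by (auto simp: u_cong_iff seq_emb_def)
  have "{..N} = {..k} \<union> {Suc k..N}" "{..k} \<inter> {Suc k..N} = {}" using k by auto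
  then have "u.ad_series c N (seq_emb X) (seq_emb Y) $ k =
      (\<Sum>p\<le>k. rat_scalar (c p) * ?E p $ k) + (\<Sum>p\<in>{Suc k..N}. rat_scalar (c p) * ?E p $ k)"
    by (simp add: u.ad_series_def fps_sum_nth sum.union_disjoint)
  \<comment> \<open>The error is split into the tail, the p-fold brackets, the rescalings and the
    outer sum.\<close>
  then have "u.ad_series c N (seq_emb X) (seq_emb Y) $ k - seq_emb (seq_ad c X Y) $ k =
      (\<Sum>p\<in>{Suc k..N}. rat_scalar (c p) * ?E p $ k)
      + (\<Sum>p\<le>k. rat_scalar (c p) * (?E p $ k - emb (?e p)))
      - (\<Sum>p\<le>k. emb (rscl (c p) (?e p)) - rat_scalar (c p) * emb (?e p))
      - (emb (\<Sum>p\<le>k. rscl (c p) (?e p)) - (\<Sum>p\<le>k. emb (rscl (c p) (?e p))))"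
    by (simp add: seq_emb_def seq_ad_def right_diff_distrib sum_subtractf)
  also have "\<dots> \<in> coeff_ideal"
  proof (intro coeff_ideal_diff[OF coeff_ideal_diff[OF coeff_ideal_add]] emb_sum)
    show "(\<Sum>p\<in>{Suc k..N}. rat_scalar (c p) * ?E p $ k) \<in> coeff_ideal"
      using tail by (intro coeff_ideal_sum coeff_ideal_mult_left) simp
    show "(\<Sum>p\<le>k. rat_scalar (c p) * (?E p $ k - emb (?e p))) \<in> coeff_ideal"
      by (rule coeff_ideal_sum, rule coeff_ideal_mult_left, rule E)
    show "(\<Sum>p\<le>k. emb (rscl (c p) (?e p)) - rat_scalar (c p) * emb (?e p)) \<in> coeff_ideal"
      by (rule coeff_ideal_sum, rule emb_scale)
  qed
  finally show "u.ad_series c N (seq_emb X) (seq_emb Y) $ k - seq_emb (seq_ad c X Y) $ k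
    \<in> coeff_ideal" .
qed

definition seq_deriv :: "(nat \<Rightarrow> 'g fps fps) \<Rightarrow> nat \<Rightarrow> 'g fps fps" where
  "seq_deriv X k = rscl (of_nat (Suc k)) (X (Suc k))"

lemma seq_emb_deriv: "u.cong n (fps_deriv (seq_emb X)) (seq_emb (seq_deriv X))"
  unfolding u_cong_iff
proof (intro allI impI)
  fix k
  show "fps_deriv (seq_emb X) $ k - seq_emb (seq_deriv X) $ k \<in> coeff_ideal"
    using coeff_ideal_neg[OF emb_scale[of "of_nat (Suc k)" "X (Suc k)"]]
    by (simp add: seq_emb_def seq_deriv_def st.Q_of_nat del: of_nat_Suc)
qed

text \<open>The coefficients of b + e^(u ad b) a, the logarithmic derivative in u of e^(u b) e^(u
  a).\<close>

definition seq_source :: "'g fps fps \<Rightarrow> 'g fps fps \<Rightarrow> nat \<Rightarrow> 'g fps fps" where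
  "seq_source a b k = rscl (1 / fact k) ((ser2_br br b ^^ k) a) + (if k = 0 then b else 0)"

lemma emb_br_funpow: "(commutator (emb b) ^^ p) (emb a) - emb ((ser2_br br b ^^ p) a) \<in> coeff_ideal"
proof (induct p)
  case (Suc p)
  let ?x = "(commutator (emb b) ^^ p) (emb a)" and ?y = "emb ((ser2_br br b ^^ p) a)"
  have "commutator (emb b) ?x - commutator (emb b) ?y = emb b * (?x - ?y) - (?x - ?y) * emb b"
    by (simp add: commutator_def algebra_simps)
  also have "\<dots> \<in> coeff_ideal"
    by (rule coeff_ideal_diff[OF coeff_ideal_mult_left[OF Suc] coeff_ideal_mult_right[OF Suc]])
  finally show ?case
    using coeff_ideal_diff[OF _ emb_br[of b "(ser2_br br b ^^ p) a"],
        of "commutator (emb b) ?x - commutator (emb b) ?y"] by simp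
qed (simp add: coeff_ideal_zero)

lemma commutator_fps_X_funpow:
  fixes b a :: "'r::ring_1"
  shows "(commutator (fps_const b * fps_X) ^^ p) (fps_const a) $ k =
    (if k = p then (commutator b ^^ p) a else 0)"
proof (induct p arbitrary: k)
  case (Suc p)
  have "commutator (fps_const b * fps_X) Z $ k =
      (if k = 0 then 0 else commutator b (Z $ (k - 1)))" for Z
    by (simp add: commutator_def mult.assoc) (simp add: mult.assoc[symmetric])
  then show ?case by (simp add: Suc) (auto simp: commutator_def)
qed simp

lemma seq_emb_source:
  "u.cong (Suc N) (seq_emb (seq_source a b))
    (fps_const (emb b) + u.ad_series (\<lambda>p. 1 / fact p) N (fps_const (emb b) * fps_X) (fps_const (emb a)))"
  unfolding u_cong_iff
proof (intro allI impI)
  fix k assume k: "k < Suc N"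
  let ?S = "fps_const (emb b) +
    u.ad_series (\<lambda>p. 1 / fact p) N (fps_const (emb b) * fps_X) (fps_const (emb a))"
  let ?x = "(commutator (emb b) ^^ k) (emb a)" and ?y = "(ser2_br br b ^^ k) a"
  have "?S $ k = (if k = 0 then emb b else 0) + rat_scalar (1 / fact k) * ?x"
    using k by (simp add: u.ad_series_def fps_sum_nth commutator_fps_X_funpow if_distrib cong: if_cong)
  then have "seq_emb (seq_source a b) $ k - ?S $ k =
      (emb (rscl (1 / fact k) ?y + (if k = 0 then b else 0))
         - (emb (rscl (1 / fact k) ?y) + emb (if k = 0 then b else 0)))
      + (emb (rscl (1 / fact k) ?y) - rat_scalar (1 / fact k) * emb ?y)
      - rat_scalar (1 / fact k) * (?x - emb ?y)
      + (if k = 0 then 0 else emb 0)"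
    by (simp add: seq_emb_def seq_source_def algebra_simps)
  also have "\<dots> \<in> coeff_ideal"
    by (intro coeff_ideal_add coeff_ideal_diff coeff_ideal_mult_left emb_add emb_scale emb_br_funpow)
      (simp add: coeff_ideal_zero emb_zero)
  finally show "seq_emb (seq_source a b) $ k - ?S $ k \<in> coeff_ideal" .
qed

section \<open>Specialization at u = 1\<close>

definition u_eval :: "nat \<Rightarrow> ('g, 'f) free_alg fps fps fps \<Rightarrow> ('g, 'f) free_alg fps fps" where
  "u_eval N X = (\<Sum>k\<le>N. X $ k)"

text \<open>Each power of u is accompanied by at least that much s,t-degree, so
  \<open>u_eval N\<close> discards only terms of degree above \<open>N\<close>. This makes it
  multiplicative up to that degree.\<close>

definition u_adic :: "('g, 'f) free_alg fps fps fps \<Rightarrow> bool" where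
  "u_adic X \<longleftrightarrow> (\<forall>k. X $ k \<in> deg_ideal k)"

lemma u_adic_mult: "u_adic X \<Longrightarrow> u_adic Y \<Longrightarrow> u_adic (X * Y)"
  unfolding u_adic_def fps_mult_nth
proof (intro allI st.F_sum)
  fix k i :: nat
  assume "\<forall>k. X $ k \<in> deg_ideal k" "\<forall>k. Y $ k \<in> deg_ideal k" "i \<in> {0..k}"
  then show "X $ i * Y $ (k - i) \<in> deg_ideal k"
    using st.F_mult[of "X $ i" i "Y $ (k - i)" "k - i"] by simp
qed

lemma u_adic_const: "u_adic (fps_const x)"
  by (simp add: u_adic_def st.F_0 st.zero_in_F)

lemma u_adic_power: "u_adic X \<Longrightarrow> u_adic (X ^ n)"
  using u_adic_const[of 1] by (induct n) (auto intro: u_adic_mult)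

lemma u_adic_trunc_exp: "u_adic X \<Longrightarrow> u_adic (u.trunc_exp M X)"
proof -
  assume "u_adic X"
  then have "u_adic (fps_const (rat_scalar (1 / fact p)) * X ^ p)" for p
    by (intro u_adic_mult u_adic_const u_adic_power)
  then show ?thesis
    by (auto simp: u_adic_def u.trunc_exp_def fps_sum_nth intro!: st.F_sum)
qed

lemma u_eval_mult:
  "u_adic X \<Longrightarrow> u_adic Y \<Longrightarrow> st.cong (Suc N) (u_eval N (X * Y)) (u_eval N X * u_eval N Y)"
  unfolding u_eval_def fps_mult_nth atLeast0AtMost u_adic_def
  by (rule st.cauchy_product_cong) auto

lemma u_eval_power: "u_adic X \<Longrightarrow> st.cong (Suc N) (u_eval N (X ^ n)) (u_eval N X ^ n)"
proof (induct n)
  case 0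
  have "(\<Sum>k\<le>N. (1 :: ('g, 'f) free_alg fps fps fps) $ k) = 1"
    by (simp add: fps_one_nth)
  then show ?case by (simp add: u_eval_def st.cong_refl)
next
  case (Suc n)
  then show ?case
    using st.cong_trans[OF u_eval_mult[OF Suc(2) u_adic_power[OF Suc(2)]]
        st.cong_mult[OF st.cong_refl Suc(1)[OF Suc(2)]]] by simp
qed

lemma u_eval_trunc_exp:
  "u_adic X \<Longrightarrow> st.cong (Suc N) (u_eval N (u.trunc_exp M X)) (st.trunc_exp M (u_eval N X))"
proof -
  assume X: "u_adic X"
  have "u_eval N (u.trunc_exp M X) = (\<Sum>p\<le>M. rat_scalar (1 / fact p) * u_eval N (X ^ p))"
    unfolding u_eval_def u.trunc_exp_def fps_sum_nth sum_distrib_left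
    by (subst sum.swap) simp
  also have "st.cong (Suc N) \<dots> (st.trunc_exp M (u_eval N X))"
    unfolding st.trunc_exp_def using X
    by (intro st.cong_sum st.cong_mult st.cong_refl u_eval_power)
  finally show ?thesis .
qed

text \<open>
  The specialization \<open>u = 1\<close> of the identity between products of exponentials.
\<close>

theorem lie_factorization:
  assumes A0: "A 0 = 0" and B0: "B 0 = 0"
    and A: "\<And>k. emb (A k) \<in> deg_ideal k" and B: "\<And>k. emb (B k) \<in> deg_ideal k"
    and a: "emb a \<in> deg_ideal 1" and b: "emb b \<in> deg_ideal 1"
    and rec: "\<And>k. seq_ad (\<lambda>p. (- 1) ^ p / fact (Suc p)) A (seq_deriv A) k
        + seq_ad (\<lambda>p. 1 / fact (Suc p)) B (seq_deriv B) k
      = seq_ad (\<lambda>p. (- 1) ^ p / fact p) A (seq_source a b) k"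
  shows "st.cong (Suc (Suc N))
    (st.trunc_exp (Suc N) (emb b) * st.trunc_exp (Suc N) (emb a))
    (st.trunc_exp (Suc N) (\<Sum>k\<le>Suc N. emb (A k)) * st.trunc_exp (Suc N) (\<Sum>k\<le>Suc N. emb (B k)))"
proof -
  let ?A = "seq_emb A" and ?B = "seq_emb B"
  let ?X = "fps_const (emb b) * fps_X" and ?Y = "fps_const (emb a) * fps_X"
  have D: "fps_deriv (fps_const c * fps_X) = fps_const c" for c :: "('g, 'f) free_alg fps fps"
    by (rule fps_ext) (simp add: fps_X_def)
  have comm: "commutator (fps_const c * fps_X) (fps_const c) = 0"
    for c :: "('g, 'f) free_alg fps fps"
    by (rule fps_ext) (simp add: commutator_def fps_X_def)
  have AB1: "?A \<in> u_ideal 1" "?B \<in> u_ideal 1"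
    using A0 B0 emb_zero by (simp_all add: u_ideal_def seq_emb_def)
  have XY1: "?X \<in> u_ideal 1" "?Y \<in> u_ideal 1"
    by (simp_all add: u_ideal_def coeff_ideal_zero)
  \<comment> \<open>The recursion \<open>rec\<close>, carried over to series in u, becomes the
    hypothesis \<open>AB\<close> of the general factorization.\<close>
  have "u.cong (Suc N)
      (u.ad_series (\<lambda>p. (- 1) ^ p / fact (Suc p)) N ?A (fps_deriv ?A)
        + u.ad_series (\<lambda>p. 1 / fact (Suc p)) N ?B (fps_deriv ?B))
      (seq_emb (seq_ad (\<lambda>p. (- 1) ^ p / fact (Suc p)) A (seq_deriv A))
        + seq_emb (seq_ad (\<lambda>p. 1 / fact (Suc p)) B (seq_deriv B)))"
    using A0 B0
    by (intro u.cong_add u.cong_trans[OF u.ad_series_cong[OF seq_emb_deriv] seq_emb_ad]) auto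
  also have "u.cong (Suc N) \<dots> (seq_emb (seq_ad (\<lambda>p. (- 1) ^ p / fact p) A (seq_source a b)))"
    unfolding u_cong_iff
  proof (intro allI impI)
    fix k
    show "(seq_emb (seq_ad (\<lambda>p. (- 1) ^ p / fact (Suc p)) A (seq_deriv A))
        + seq_emb (seq_ad (\<lambda>p. 1 / fact (Suc p)) B (seq_deriv B))) $ k
        - seq_emb (seq_ad (\<lambda>p. (- 1) ^ p / fact p) A (seq_source a b)) $ k \<in> coeff_ideal"
      using coeff_ideal_neg[OF emb_add] by (simp add: seq_emb_def rec[symmetric] del: fact_Suc)
  qed
  also have "u.cong (Suc N) \<dots>
      (u.ad_series (\<lambda>p. (- 1) ^ p / fact p) N ?A (seq_emb (seq_source a b)))"
    using A0 by (intro u.cong_sym[OF seq_emb_ad])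
  finally have "u.cong (Suc (Suc N))
      (u.trunc_exp (Suc N) ?X * u.trunc_exp (Suc N) ?Y)
      (u.trunc_exp (Suc N) ?A * u.trunc_exp (Suc N) ?B)"
    using AB1 XY1 comm seq_emb_source[of N a b]
    by (intro u.trunc_exp_factorization[where c = "seq_emb (seq_source a b)"]) (simp_all add: D)
  \<comment> \<open>\<open>u_eval (Suc N)\<close> reads exactly the coefficients covered by the
    congruence, so the difference lies in \<open>coeff_ideal\<close> without loss of degree.\<close>
  then have "u_eval (Suc N) (u.trunc_exp (Suc N) ?X * u.trunc_exp (Suc N) ?Y)
      - u_eval (Suc N) (u.trunc_exp (Suc N) ?A * u.trunc_exp (Suc N) ?B) \<in> coeff_ideal"
    unfolding u_eval_def sum_subtractf[symmetric] u_cong_iff by (intro coeff_ideal_sum) auto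
  then have eval: "st.cong (Suc (Suc N))
      (u_eval (Suc N) (u.trunc_exp (Suc N) ?X * u.trunc_exp (Suc N) ?Y))
      (u_eval (Suc N) (u.trunc_exp (Suc N) ?A * u.trunc_exp (Suc N) ?B))"
    unfolding st.cong_def by (rule coeff_ideal_deg_ideal)
  have prod: "st.cong (Suc (Suc N)) (u_eval (Suc N) (u.trunc_exp (Suc N) V * u.trunc_exp (Suc N) W))
      (st.trunc_exp (Suc N) (u_eval (Suc N) V) * st.trunc_exp (Suc N) (u_eval (Suc N) W))"
    if "u_adic V" "u_adic W" for V W
    using that
    by (intro st.cong_trans[OF u_eval_mult] st.cong_mult u_eval_trunc_exp u_adic_trunc_exp)
  have ev: "u_eval (Suc N) (fps_const c * fps_X) = c" for c :: "('g, 'f) free_alg fps fps"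
    by (simp add: u_eval_def fps_X_def if_distrib cong: if_cong)
  have adic: "u_adic ?X" "u_adic ?Y" "u_adic ?A" "u_adic ?B"
    using A B a b by (auto simp: u_adic_def fps_X_def seq_emb_def st.zero_in_F)
  have "u_eval (Suc N) ?A = (\<Sum>k\<le>Suc N. emb (A k))" "u_eval (Suc N) ?B = (\<Sum>k\<le>Suc N. emb (B k))"
    by (simp_all add: u_eval_def seq_emb_def)
  then show ?thesis
    using st.cong_trans[OF st.cong_trans[OF st.cong_sym[OF prod[OF adic(1,2)]] eval] prod[OF adic(3,4)]]
    by (simp add: ev)
qed

end

section \<open>Uniqueness of the factorization\<close>

context filtered_algebra
begin

text \<open>Telescoping: each further factor lies in \<open>F 1\<close> and raises the order of the
  difference by one. Hence only the linear term of an exponential sees the leading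
  difference.\<close>

lemma F_power_diff:
  assumes "U \<in> F 1" "U' \<in> F 1" "U - U' \<in> F d"
  shows "U ^ Suc p - U' ^ Suc p \<in> F (d + p)"
proof (induct p)
  case (Suc p)
  have "U ^ Suc (Suc p) - U' ^ Suc (Suc p) = (U ^ Suc p - U' ^ Suc p) * U + U' ^ Suc p * (U - U')"
    by (simp only: power_Suc2[of _ "Suc p"] left_diff_distrib right_diff_distrib) simp
  also have "\<dots> \<in> F (d + Suc p)"
    using F_mult[OF Suc assms(1)] F_mult[OF F_power[OF assms(2), of "Suc p"] assms(3)]
    by (intro F_add) (simp_all add: add_ac)
  finally show ?case .
qed (use assms in simp)

lemma trunc_exp_diff_cong:
  assumes "U \<in> F 1" "U' \<in> F 1" "U - U' \<in> F d"
  shows "cong (Suc d) (trunc_exp (Suc N) U - trunc_exp (Suc N) U') (U - U')"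
proof (induct N)
  case 0
  then show ?case by (auto simp: trunc_exp_def Q_1)
next
  case (Suc N)
  let ?t = "Q (1 / fact (Suc (Suc N))) * (U ^ Suc (Suc N) - U' ^ Suc (Suc N))"
  have "?t \<in> F (Suc d)"
    by (rule F_mult_left, rule F_antimono[OF F_power_diff[OF assms]]) simp
  then have "cong (Suc d) (trunc_exp (Suc N) U - trunc_exp (Suc N) U' + ?t) (U - U' + 0)"
    by (intro cong_add Suc) (simp add: cong_def)
  moreover have "trunc_exp (Suc (Suc N)) U - trunc_exp (Suc (Suc N)) U' =
      trunc_exp (Suc N) U - trunc_exp (Suc N) U' + ?t"
    unfolding trunc_exp_def sum.atMost_Suc[of _ "Suc N"] right_diff_distrib
    by (simp only: add_diff_add)
  ultimately show ?case by simp
qed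

text \<open>A factor that is 1 modulo \<open>F 1\<close> does not change a leading difference. The
  two products therefore differ, to first order, by the sum of the two differences.\<close>

lemma trunc_exp_product_cancel:
  assumes F1: "U \<in> F 1" "U' \<in> F 1" "V \<in> F 1" "V' \<in> F 1"
    and d: "U - U' \<in> F d" "V - V' \<in> F d"
    and eq: "cong (Suc d) (trunc_exp (Suc N) U * trunc_exp (Suc N) V)
      (trunc_exp (Suc N) U' * trunc_exp (Suc N) V')"
  shows "(U - U') + (V - V') \<in> F (Suc d)"
proof -
  let ?e = "trunc_exp (Suc N)"
  have U: "cong (Suc d) (?e U - ?e U') (U - U')" and V: "cong (Suc d) (?e V - ?e V') (V - V')"
    using F1 d by (intro trunc_exp_diff_cong; simp)+
  have Ud: "?e U - ?e U' \<in> F d" and Vd: "?e V - ?e V' \<in> F d"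
    using F_add[OF F_antimono[OF U[unfolded cong_def], of d] d(1)]
      F_add[OF F_antimono[OF V[unfolded cong_def], of d] d(2)] by simp_all
  have "cong (Suc d) ((?e U - ?e U') * ?e V) (?e U - ?e U')"
    using F_mult[OF Ud trunc_exp_cong_1[OF F1(3), of "Suc N", unfolded cong_def]]
    by (simp add: cong_def right_diff_distrib)
  moreover have "cong (Suc d) (?e U' * (?e V - ?e V')) (?e V - ?e V')"
    using F_mult[OF trunc_exp_cong_1[OF F1(2), of "Suc N", unfolded cong_def] Vd]
    by (simp add: cong_def left_diff_distrib)
  ultimately have "cong (Suc d) ((?e U - ?e U') * ?e V + ?e U' * (?e V - ?e V'))
      ((U - U') + (V - V'))"
    using U V by (intro cong_add) (auto intro: cong_trans)
  moreover have "(?e U - ?e U') * ?e V + ?e U' * (?e V - ?e V') = ?e U * ?e V - ?e U' * ?e V'"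
    by (simp add: algebra_simps)
  ultimately show ?thesis
    using eq F_diff by (fastforce simp: cong_def)
qed

end

locale lie_decomposition_char_0 = lie_decomposition scl br gM gP
  for scl :: "'f::field_char_0 \<Rightarrow> 'g::ab_group_add \<Rightarrow> 'g" and br :: "'g \<Rightarrow> 'g \<Rightarrow> 'g"
    and gM gP :: "'g set"
begin

sublocale lie_algebra_char_0 scl br ..

text \<open>\<open>ser2_exp\<close> cuts each coefficient at its own degree. The extra terms of a
  uniform truncation may be nonzero in the free algebra, but they lie in the ideal.\<close>

lemma ser2_exp_cong:
  assumes "X \<in> deg_ideal 1"
  shows "st.cong (Suc N) (ser2_exp X) (st.trunc_exp N X)"
  unfolding st.cong_def deg_ideal_def
proof (intro CollectI allI impI)
  fix i j assume ij: "i + j < Suc N"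
  let ?t = "\<lambda>k. scalar (1 / fact k) * (X ^ k) $ i $ j"
  have "{..N} = {..i + j} \<union> {Suc (i + j)..N}" "{..i + j} \<inter> {Suc (i + j)..N} = {}"
    using ij by auto
  then have "(\<Sum>k\<le>N. ?t k) = (\<Sum>k\<le>i + j. ?t k) + (\<Sum>k\<in>{Suc (i + j)..N}. ?t k)"
    by (simp add: sum.union_disjoint)
  moreover have "of_rat (fact k) = (fact k :: 'f)" for k
    by (metis of_nat_fact of_rat_of_nat_eq)
  ultimately have "(ser2_exp X - st.trunc_exp N X) $ i $ j = - (\<Sum>k\<in>{Suc (i + j)..N}. ?t k)"
    by (simp add: ser2_exp_def st.trunc_exp_def sum_nth_nth rat_scalar_mult_nth of_rat_divide)
  also have "\<dots> \<in> UI"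
  proof (intro UI_neg UI_sum uea_ideal.mult_left)
    fix k assume "k \<in> {Suc (i + j)..N}"
    then show "(X ^ k) $ i $ j \<in> UI"
      using st.F_power[OF assms, of k] by (simp add: deg_ideal_def)
  qed
  finally show "(ser2_exp X - st.trunc_exp N X) $ i $ j \<in> UI" .
qed

lemma emb_deg_ideal: "(\<And>i j. i + j < n \<Longrightarrow> X $ i $ j = 0) \<Longrightarrow> emb X \<in> deg_ideal n"
  by (simp add: deg_ideal_def ser2_gen_def gen_zero)

lemma factorization_unique:
  assumes X: "X \<in> ser2_in gM" "X' \<in> ser2_in gM" "X $ 0 $ 0 = 0" "X' $ 0 $ 0 = 0"
    and Y: "Y \<in> ser2_in gP" "Y' \<in> ser2_in gP" "Y $ 0 $ 0 = 0" "Y' $ 0 $ 0 = 0"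
    and eq: "\<And>N. st.cong (Suc (Suc N))
      (st.trunc_exp (Suc N) (emb X) * st.trunc_exp (Suc N) (emb Y))
      (st.trunc_exp (Suc N) (emb X') * st.trunc_exp (Suc N) (emb Y'))"
  shows "X = X' \<and> Y = Y'"
proof -
  have "\<forall>i j. i + j < d \<longrightarrow> X $ i $ j = X' $ i $ j \<and> Y $ i $ j = Y' $ i $ j" for d
  proof (induct d)
    case (Suc d)
    show ?case
    proof (cases d)
      \<comment> \<open>Degree zero is settled by the vanishing constant terms; afterwards
        \<open>d = Suc N\<close> fits the truncation in \<open>eq\<close>.\<close>
      case 0
      then show ?thesis using X Y by simp
    next
      case d: (Suc N)
      have F1: "emb X \<in> deg_ideal 1" "emb X' \<in> deg_ideal 1"
        "emb Y \<in> deg_ideal 1" "emb Y' \<in> deg_ideal 1"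
        using X Y by (auto intro!: emb_deg_ideal)
      have "emb X - emb X' \<in> deg_ideal d" "emb Y - emb Y' \<in> deg_ideal d"
        using Suc by (simp_all add: deg_ideal_def ser2_gen_def UI_zero)
      from st.trunc_exp_product_cancel[OF F1 this, of N] eq[of N]
      have *: "(emb X - emb X') + (emb Y - emb Y') \<in> deg_ideal (Suc d)" by (simp add: d)
      show ?thesis
      proof (intro allI impI)
        fix i j assume ij: "i + j < Suc d"
        let ?x = "X $ i $ j" and ?x' = "X' $ i $ j" and ?y = "Y $ i $ j" and ?y' = "Y' $ i $ j"
        have "gen ?x - gen ?x' + (gen ?y - gen ?y') \<in> UI"
          using * ij by (simp add: deg_ideal_def ser2_gen_def)
        \<comment> \<open>Three instances of additivity merge the four generators into one, to which
          injectivity applies.\<close>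
        moreover have "gen (u + v) - (gen u + gen v) \<in> UI" for u v
          by (rule uea_ideal.gen_add)
        from uea_ideal.add[OF this[of "?x - ?x'" "?y - ?y'"]
            UI_neg[OF uea_ideal.add[OF this[of "?x - ?x'" ?x'] this[of "?y - ?y'" ?y']]]]
        have "gen (?x - ?x' + (?y - ?y')) - (gen ?x - gen ?x' + (gen ?y - gen ?y')) \<in> UI"
          by (simp add: algebra_simps)
        ultimately have "gen (?x - ?x' + (?y - ?y')) \<in> UI"
          using uea_ideal.add by fastforce
        then have 0: "?x - ?x' + (?y - ?y') = 0" by (rule gen_in_uea_ideal)
        have "?x - ?x' \<in> gM" "?y' - ?y \<in> gP"
          using X Y subspace_diff[OF subspace_gM] subspace_diff[OF subspace_gP]
          by (auto simp: ser2_in_def)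
        moreover have "?x - ?x' = ?y' - ?y" using 0 by (simp add: algebra_simps)
        ultimately have "?x - ?x' \<in> gM \<inter> gP" by simp
        then show "?x = ?x' \<and> ?y = ?y'" using gM_inter_gP 0 by simp
      qed
    qed
  qed simp
  then show ?thesis by (auto intro!: ser2_eqI)
qed

section \<open>Projections and brackets of series\<close>

lemma decomposition_unique:
  assumes "y \<in> gM" "z \<in> gP" "y' \<in> gM" "z' \<in> gP" "y + z = y' + z'"
  shows "y = y'" "z = z'"
proof -
  have eq: "y - y' = z' - z" using assms(5) by (simp add: algebra_simps)
  then have "y - y' \<in> gM \<inter> gP"
    using subspace_diff[OF subspace_gM assms(1,3)] subspace_diff[OF subspace_gP assms(4,2)] by simp
  then show "y = y'" "z = z'" using gM_inter_gP eq by auto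
qed

lemma proj_along_add:
  assumes "y \<in> gM" "z \<in> gP"
  shows "proj_along gM gP (y + z) = y" "proj_along gP gM (y + z) = z"
proof -
  have *: "w = y" if "w \<in> gM" "y + z - w \<in> gP" for w
    using decomposition_unique(1)[of w "y + z - w" y z] that assms by simp
  show "proj_along gM gP (y + z) = y"
    unfolding proj_along_def by (rule the_equality) (use assms * in auto)
  have *: "w = z" if "w \<in> gP" "y + z - w \<in> gM" for w
    using decomposition_unique(2)[of "y + z - w" w y z] that assms by simp
  show "proj_along gP gM (y + z) = z"
    unfolding proj_along_def by (rule the_equality) (use assms * in auto)
qed

lemma proj_along_in: "proj_along gM gP x \<in> gM" "proj_along gP gM x \<in> gP"
  and proj_along_sum: "proj_along gM gP x + proj_along gP gM x = x"
  and proj_along_plus: "proj_along gM gP (x + y) = proj_along gM gP x + proj_along gM gP y"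
    "proj_along gP gM (x + y) = proj_along gP gM x + proj_along gP gM y"
  and proj_along_scale: "proj_along gM gP (scl c x) = scl c (proj_along gM gP x)"
    "proj_along gP gM (scl c x) = scl c (proj_along gP gM x)"
proof -
  obtain u v where x: "x = u + v" "u \<in> gM" "v \<in> gP" using gM_plus_gP[of x] by blast
  obtain u' v' where y: "y = u' + v'" "u' \<in> gM" "v' \<in> gP" using gM_plus_gP[of y] by blast
  show "proj_along gM gP x \<in> gM" "proj_along gP gM x \<in> gP"
    "proj_along gM gP x + proj_along gP gM x = x"
    using x proj_along_add by auto
  have "x + y = (u + u') + (v + v')" using x y by (simp add: algebra_simps)
  moreover have "u + u' \<in> gM" "v + v' \<in> gP"
    using x y subspace_gM subspace_gP by (auto intro: subspace_add)
  ultimately show "proj_along gM gP (x + y) = proj_along gM gP x + proj_along gM gP y"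
    "proj_along gP gM (x + y) = proj_along gP gM x + proj_along gP gM y"
    using x y by (simp_all only: proj_along_add)
  have "scl c x = scl c u + scl c v" using x by (simp add: scale_right_distrib)
  moreover have "scl c u \<in> gM" "scl c v \<in> gP"
    using x subspace_gM subspace_gP by (auto intro: subspace_scale)
  ultimately show "proj_along gM gP (scl c x) = scl c (proj_along gM gP x)"
    "proj_along gP gM (scl c x) = scl c (proj_along gP gM x)"
    using x by (simp_all only: proj_along_add)
qed

lemma proj_along_gM: "x \<in> gM \<Longrightarrow> proj_along gM gP x = x" "x \<in> gM \<Longrightarrow> proj_along gP gM x = 0"
  and proj_along_gP: "x \<in> gP \<Longrightarrow> proj_along gP gM x = x" "x \<in> gP \<Longrightarrow> proj_along gM gP x = 0"
  using proj_along_add[of x 0] proj_along_add[of 0 x] subspace_0[OF subspace_gM]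
    subspace_0[OF subspace_gP] by auto

lemma proj_along_zero: "proj_along gM gP 0 = 0" "proj_along gP gM 0 = 0"
  using proj_along_gM[of 0] proj_along_gP[of 0] subspace_0[OF subspace_gM]
    subspace_0[OF subspace_gP] by auto

abbreviation projM :: "'g fps fps \<Rightarrow> 'g fps fps" where
  "projM \<equiv> ser2_proj gM gP"

abbreviation projP :: "'g fps fps \<Rightarrow> 'g fps fps" where
  "projP \<equiv> ser2_proj gP gM"

lemma ser2_proj_in: "projM X \<in> ser2_in gM" "projP X \<in> ser2_in gP"
  by (simp_all add: ser2_in_def ser2_proj_def proj_along_in)

lemma ser2_proj_sum: "projM X + projP X = X"
  by (rule ser2_eqI) (simp add: ser2_proj_def proj_along_sum)

lemma ser2_proj_plus: "projM (X + Y) = projM X + projM Y" "projP (X + Y) = projP X + projP Y"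
  by (rule ser2_eqI, simp add: ser2_proj_def proj_along_plus)+

lemma ser2_proj_scale: "projM (ser2_scl scl c X) = ser2_scl scl c (projM X)"
  "projP (ser2_scl scl c X) = ser2_scl scl c (projP X)"
  by (rule ser2_eqI, simp add: ser2_proj_def ser2_scl_def proj_along_scale)+

lemma ser2_proj_zero: "projM 0 = 0" "projP 0 = 0"
  by (rule ser2_eqI, simp add: ser2_proj_def proj_along_zero)+

lemma ser2_proj_gM: "X \<in> ser2_in gM \<Longrightarrow> projM X = X" "X \<in> ser2_in gM \<Longrightarrow> projP X = 0"
  and ser2_proj_gP: "X \<in> ser2_in gP \<Longrightarrow> projP X = X" "X \<in> ser2_in gP \<Longrightarrow> projM X = 0"
  by (auto intro!: ser2_eqI simp: ser2_in_def ser2_proj_def proj_along_gM proj_along_gP)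

sublocale ser: vector_space "ser2_scl scl :: 'f \<Rightarrow> 'g fps fps \<Rightarrow> 'g fps fps"
  by standard
    (auto intro!: ser2_eqI simp: ser2_scl_def scale_right_distrib scale_left_distrib)

lemma ser2_br_add_left: "ser2_br br (X + Y) Z = ser2_br br X Z + ser2_br br Y Z"
  by (rule ser2_eqI) (simp add: ser2_br_def br_add_left sum.distrib)

lemma ser2_br_add_right: "ser2_br br X (Y + Z) = ser2_br br X Y + ser2_br br X Z"
  by (rule ser2_eqI) (simp add: ser2_br_def br_add_right sum.distrib)

lemma ser2_br_scale_left: "ser2_br br (ser2_scl scl c X) Y = ser2_scl scl c (ser2_br br X Y)"
  by (rule ser2_eqI) (simp add: ser2_br_def ser2_scl_def br_scale_left scale_sum_right)

lemma ser2_br_scale_right: "ser2_br br X (ser2_scl scl c Y) = ser2_scl scl c (ser2_br br X Y)"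
  by (rule ser2_eqI) (simp add: ser2_br_def ser2_scl_def br_scale_right scale_sum_right)

lemma ser2_br_zero: "ser2_br br 0 Y = 0" "ser2_br br X 0 = 0"
  by (rule ser2_eqI, simp add: ser2_br_def br_zero)+

lemma ser2_br_anti: "ser2_br br Y X = - ser2_br br X Y"
proof (rule ser2_eqI)
  fix m n
  have "ser2_br br Y X $ m $ n = (\<Sum>i\<le>m. \<Sum>j\<le>n. br (Y $ (m - i) $ (n - j)) (X $ i $ j))"
    unfolding ser2_br_def ser2_nth
    by (subst sum_atMost_reflect[symmetric], rule sum.cong[OF refl],
        subst sum_atMost_reflect[symmetric], rule sum.cong[OF refl]) simp
  also have "\<dots> = - ser2_br br X Y $ m $ n"
    by (simp add: ser2_br_def sum_negf[symmetric] br_anti[of "Y $ _ $ _"])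
  finally show "ser2_br br Y X $ m $ n = (- ser2_br br X Y) $ m $ n" by simp
qed

text \<open>Antisymmetry shows that twice the bracket is zero, and 2 is invertible.\<close>

lemma ser2_br_self: "ser2_br br X X = 0"
proof -
  have "ser2_scl scl 2 (ser2_br br X X) = ser2_br br X X + ser2_br br X X"
    using ser.scale_left_distrib[of 1 1 "ser2_br br X X"] by simp
  also have "\<dots> = 0" using ser2_br_anti[of X X] by (simp add: eq_neg_iff_add_eq_0)
  finally show ?thesis using ser.scale_eq_0_iff by auto
qed

end

section \<open>Evaluation of the canonical series\<close>

definition sol_minus :: "nat \<Rightarrow> word_comb" where
  "sol_minus k = fst (gr_solution k) k"

definition sol_plus :: "nat \<Rightarrow> word_comb" where
  "sol_plus k = snd (gr_solution k) k"

lemma gr_solution_Suc: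
  "fst (gr_solution (Suc j)) = (fst (gr_solution j))(Suc (Suc j) :=
     wc_map WPm (wc_scale (1 / of_nat (Suc (Suc j)))
       (gr_rhs (fst (gr_solution j)) (snd (gr_solution j)) (Suc j))))"
  "snd (gr_solution (Suc j)) = (snd (gr_solution j))(Suc (Suc j) :=
     wc_map WPp (wc_scale (1 / of_nat (Suc (Suc j)))
       (gr_rhs (fst (gr_solution j)) (snd (gr_solution j)) (Suc j))))"
  by (simp_all add: case_prod_unfold Let_def)

text \<open>Stage \<open>Suc j\<close> writes only degree \<open>Suc (Suc j)\<close>, so stage
  \<open>j\<close> is final up to degree \<open>Suc j\<close>.\<close>

lemma gr_solution_stable:
  "k \<le> Suc j \<Longrightarrow> fst (gr_solution (j + i)) k = fst (gr_solution j) k"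
  "k \<le> Suc j \<Longrightarrow> snd (gr_solution (j + i)) k = snd (gr_solution j) k"
  by (induct i) (auto simp del: gr_solution.simps simp: gr_solution_Suc)

lemma gr_solution_eq_sol:
  assumes "k \<le> Suc j"
  shows "fst (gr_solution j) k = sol_minus k" "snd (gr_solution j) k = sol_plus k"
proof -
  have "fst (gr_solution j) k = sol_minus k \<and> snd (gr_solution j) k = sol_plus k"
  proof (cases "k \<le> j")
    case True
    then show ?thesis
      using gr_solution_stable[of k k "j - k"] by (simp add: sol_minus_def sol_plus_def)
  next
    case False
    then have "k = j + 1" using assms by simp
    then show ?thesis
      using gr_solution_stable[of k j 1] assms by (simp add: sol_minus_def sol_plus_def)
  qed
  then show "fst (gr_solution j) k = sol_minus k" "snd (gr_solution j) k = sol_plus k" by simp_all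
qed

lemma sol_0: "sol_minus 0 = []" "sol_plus 0 = []"
  by (simp_all add: sol_minus_def sol_plus_def)

lemma sol_1: "sol_minus (Suc 0) = [(1, WA)]" "sol_plus (Suc 0) = [(1, WB)]"
  using gr_solution_eq_sol[of 1 0] by simp_all

lemma sol_Suc_Suc:
  "sol_minus (Suc (Suc j)) = wc_map WPm (wc_scale (1 / of_nat (Suc (Suc j)))
       (gr_rhs (fst (gr_solution j)) (snd (gr_solution j)) (Suc j)))"
  "sol_plus (Suc (Suc j)) = wc_map WPp (wc_scale (1 / of_nat (Suc (Suc j)))
       (gr_rhs (fst (gr_solution j)) (snd (gr_solution j)) (Suc j)))"
  using gr_solution_eq_sol[of "Suc (Suc j)" "Suc j"]
  by (simp_all del: gr_solution.simps add: gr_solution_Suc)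

lemma G_minus_eq: "G_minus m n = filter (\<lambda>(c, w). bideg w = (m, n)) (sol_minus (m + n))"
  by (simp add: G_minus_def sol_minus_def)

lemma G_plus_eq: "G_plus m n = filter (\<lambda>(c, w). bideg w = (m, n)) (sol_plus (m + n))"
  by (simp add: G_plus_def sol_plus_def)

section \<open>Letter counts\<close>

definition tdeg :: "lie_word \<Rightarrow> nat" where
  "tdeg w = fst (bideg w) + snd (bideg w)"

lemma tdeg_simps [simp]: "tdeg WA = 1" "tdeg WB = 1" "tdeg (WBr v w) = tdeg v + tdeg w"
  "tdeg (WPm w) = tdeg w" "tdeg (WPp w) = tdeg w"
  by (simp_all add: tdeg_def)

text \<open>The shift \<open>d\<close> is 0 for the solution and 1 for derivatives and the source,
  whose index is one less than their number of letters.\<close>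

definition homogeneous :: "nat \<Rightarrow> (nat \<Rightarrow> word_comb) \<Rightarrow> bool" where
  "homogeneous d X \<longleftrightarrow> (\<forall>k. \<forall>(c, w)\<in>set (X k). tdeg w = k + d)"

lemma set_wc_scale: "set (wc_scale c xs) = (\<lambda>(d, w). (c * d, w)) ` set xs"
  by (simp add: wc_scale_def)

lemma homogeneous_fun_upd:
  "homogeneous d X \<Longrightarrow> \<forall>(c, w)\<in>set xs. tdeg w = k + d \<Longrightarrow> homogeneous d (X(k := xs))"
  by (simp add: homogeneous_def)

lemma homogeneous_br:
  "homogeneous d X \<Longrightarrow> homogeneous e Y \<Longrightarrow> homogeneous (d + e) (gr_br X Y)"
  by (fastforce simp: homogeneous_def gr_br_def wc_br_def)

lemma homogeneous_br_funpow: "homogeneous 0 X \<Longrightarrow> homogeneous e Y \<Longrightarrow> homogeneous e ((gr_br X ^^ p) Y)"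
  using homogeneous_br[of 0 X e] by (induct p) simp_all

lemma homogeneous_ad_series:
  "homogeneous 0 X \<Longrightarrow> homogeneous e Y \<Longrightarrow> homogeneous e (gr_ad_series c X Y)"
  using homogeneous_br_funpow[of X e Y]
  unfolding homogeneous_def gr_ad_series_def by (fastforce simp: set_wc_scale)

lemma homogeneous_deriv: "homogeneous 0 X \<Longrightarrow> homogeneous 1 (gr_deriv X)"
  by (fastforce simp: homogeneous_def gr_deriv_def set_wc_scale)

lemma tdeg_br_funpow: "tdeg ((WBr WB ^^ k) WA) = Suc k"
  by (induct k) auto

lemma homogeneous_source: "homogeneous 1 gr_source"
  by (auto simp: homogeneous_def gr_source_def tdeg_br_funpow)

lemma homogeneous_rhs: "homogeneous 0 A \<Longrightarrow> homogeneous 0 B \<Longrightarrow> homogeneous 1 (gr_rhs A B)"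
proof -
  assume "homogeneous 0 A" "homogeneous 0 B"
  then have "homogeneous 1 (gr_ad_series c A gr_source)" "homogeneous 1 (gr_ad_series c A (gr_deriv A))"
    "homogeneous 1 (gr_ad_series c B (gr_deriv B))" for c
    by (intro homogeneous_ad_series homogeneous_source homogeneous_deriv; simp)+
  then show ?thesis unfolding homogeneous_def gr_rhs_def by fastforce
qed

lemma homogeneous_solution:
  "homogeneous 0 (fst (gr_solution j)) \<and> homogeneous 0 (snd (gr_solution j))"
proof (induct j)
  case 0
  then show ?case by (auto simp: homogeneous_def)
next
  case (Suc j)
  then have "homogeneous 1 (gr_rhs (fst (gr_solution j)) (snd (gr_solution j)))"
    by (intro homogeneous_rhs) simp_all
  then have "\<forall>(c, w)\<in>set (gr_rhs (fst (gr_solution j)) (snd (gr_solution j)) (Suc j)).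
      tdeg w = Suc (Suc j)"
    by (simp add: homogeneous_def)
  then have upd: "\<forall>(c, w)\<in>set (wc_map f (wc_scale r
      (gr_rhs (fst (gr_solution j)) (snd (gr_solution j)) (Suc j)))). tdeg w = Suc (Suc j) + 0"
    if "\<And>w. tdeg (f w) = tdeg w" for f r
    using that by (fastforce simp: wc_map_def set_wc_scale)
  show ?case
    using Suc unfolding gr_solution_Suc by (intro conjI homogeneous_fun_upd upd) simp_all
qed

lemma homogeneous_sol: "homogeneous 0 sol_minus" "homogeneous 0 sol_plus"
  using homogeneous_solution by (simp_all add: homogeneous_def sol_minus_def sol_plus_def)

section \<open>Evaluation of formal combinations\<close>

locale word_evaluation = lie_decomposition_char_0 scl br gM gP
  for scl :: "'f::field_char_0 \<Rightarrow> 'g::ab_group_add \<Rightarrow> 'g" and br :: "'g \<Rightarrow> 'g \<Rightarrow> 'g"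
    and gM gP :: "'g set" +
  fixes a b :: "'g fps fps"
  assumes a_in: "a \<in> ser2_in gM" and b_in: "b \<in> ser2_in gP"
    and a_nth_0: "a $ 0 $ j = 0" and b_nth_0: "b $ i $ 0 = 0"
begin

abbreviation evw :: "lie_word \<Rightarrow> 'g fps fps" where
  "evw \<equiv> eval_word br gM gP a b"

abbreviation evc :: "word_comb \<Rightarrow> 'g fps fps" where
  "evc \<equiv> eval_comb scl br gM gP a b"

lemma evc_Nil [simp]: "evc [] = 0"
  by (simp add: eval_comb_def)

lemma evc_Cons: "evc ((c, w) # xs) = rscl c (evw w) + evc xs"
  by (simp add: eval_comb_def)

lemma evc_append [simp]: "evc (xs @ ys) = evc xs + evc ys"
  by (simp add: eval_comb_def)

lemma evc_concat_upt: "evc (concat (map f [0..<Suc k])) = (\<Sum>i\<le>k. evc (f i))"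
  by (induct k) simp_all

lemma evc_scale: "evc (wc_scale c xs) = rscl c (evc xs)"
  by (induct xs)
    (auto simp: wc_scale_def evc_Cons ser.scale_right_distrib of_rat_mult)

lemma evc_map:
  "evc (wc_map WPm xs) = projM (evc xs)" "evc (wc_map WPp xs) = projP (evc xs)"
  by (induct xs)
    (auto simp: wc_map_def evc_Cons ser2_proj_zero ser2_proj_plus ser2_proj_scale)

lemma evc_br: "evc (wc_br xs ys) = ser2_br br (evc xs) (evc ys)"
proof -
  have "evc (map (\<lambda>(d, w). (c * d, WBr v w)) ys) = rscl c (ser2_br br (evw v) (evc ys))" for c v
    by (induct ys) (auto simp: evc_Cons ser2_br_zero ser2_br_add_right ser2_br_scale_right
        ser.scale_right_distrib of_rat_mult)
  then show ?thesis
    by (induct xs) (auto simp: wc_br_def evc_Cons ser2_br_zero ser2_br_add_left ser2_br_scale_left)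
qed

lemma evc_gr_br: "(\<lambda>k. evc (gr_br X Y k)) = seq_br (\<lambda>k. evc (X k)) (\<lambda>k. evc (Y k))"
  unfolding gr_br_def seq_br_def evc_concat_upt evc_br ..

lemma evc_gr_br_funpow:
  "(\<lambda>k. evc ((gr_br X ^^ p) Y k)) = (seq_br (\<lambda>k. evc (X k)) ^^ p) (\<lambda>k. evc (Y k))"
  by (induct p) (simp_all add: evc_gr_br)

lemma evc_gr_ad_series:
  "evc (gr_ad_series c X Y k) = seq_ad c (\<lambda>k. evc (X k)) (\<lambda>k. evc (Y k)) k"
  unfolding gr_ad_series_def seq_ad_def evc_concat_upt evc_scale evc_gr_br_funpow[symmetric] ..

lemma evc_gr_deriv: "(\<lambda>k. evc (gr_deriv X k)) = seq_deriv (\<lambda>k. evc (X k))"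
  unfolding gr_deriv_def seq_deriv_def evc_scale ..

lemma evc_gr_source: "(\<lambda>k. evc (gr_source k)) = seq_source a b"
proof
  fix k
  have "evw ((WBr WB ^^ k) WA) = (ser2_br br b ^^ k) a" by (induct k) simp_all
  then show "evc (gr_source k) = seq_source a b k"
    by (simp add: gr_source_def seq_source_def evc_Cons)
qed

lemma evc_gr_rhs:
  "evc (gr_rhs A B k) =
     seq_ad (\<lambda>p. (- 1) ^ p / fact p) (\<lambda>k. evc (A k)) (seq_source a b) k
     + seq_ad (\<lambda>p. if p = 0 then 0 else - ((- 1) ^ p / fact (Suc p)))
         (\<lambda>k. evc (A k)) (seq_deriv (\<lambda>k. evc (A k))) k
     + seq_ad (\<lambda>p. if p = 0 then 0 else - (1 / fact (Suc p)))
         (\<lambda>k. evc (B k)) (seq_deriv (\<lambda>k. evc (B k))) k"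
  unfolding gr_rhs_def evc_append evc_gr_ad_series evc_gr_deriv evc_gr_source by (simp add: add.assoc)

section \<open>The recursion satisfied by the values\<close>

lemma seq_br_funpow_local:
  assumes "\<And>i. i \<le> k \<Longrightarrow> X i = X' i" "\<And>i. i \<le> k \<Longrightarrow> Y i = Y' i" "l \<le> k"
  shows "(seq_br X ^^ p) Y l = (seq_br X' ^^ p) Y' l"
  using assms(3)
proof (induct p arbitrary: l)
  case (Suc p)
  then show ?case using assms(1) by (simp add: seq_br_def)
qed (use assms in simp)

text \<open>Since \<open>X 0 = 0\<close>, a bracket with \<open>X\<close> uses up a degree, and the
  last entry of \<open>Y\<close> is never reached. This matters when \<open>Y\<close> is a
  derivative: its entry \<open>k\<close> contains the still unknown entry
  \<open>Suc k\<close>.\<close>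

lemma seq_br_funpow_local':
  assumes X: "\<And>i. i \<le> k \<Longrightarrow> X i = X' i" and Y: "\<And>i. i < k \<Longrightarrow> Y i = Y' i" and X0: "X 0 = 0"
  shows "(seq_br X ^^ Suc p) Y k = (seq_br X' ^^ Suc p) Y' k"
proof -
  have "ser2_br br (X i) ((seq_br X ^^ p) Y (k - i)) = ser2_br br (X' i) ((seq_br X' ^^ p) Y' (k - i))"
    if "i \<le> k" for i
  proof (cases i)
    case 0
    then show ?thesis using X[of 0] X0 by (simp add: ser2_br_zero)
  next
    case (Suc l)
    then show ?thesis
      using seq_br_funpow_local[of "k - 1" X X' Y Y' "k - i" p] X Y X[OF that] that by simp
  qed
  then show ?thesis by (simp add: seq_br_def)
qed

text \<open>\<open>c 0 = 0\<close> removes the one term reading \<open>Y k\<close>. This is why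
  \<open>gr_rhs\<close> leaves out \<open>p = 0\<close> in its derivative terms.\<close>

lemma seq_ad_local:
  assumes X: "\<And>i. i \<le> k \<Longrightarrow> X i = X' i" and Y: "\<And>i. i < k \<Longrightarrow> Y i = Y' i" and X0: "X 0 = 0"
    and c0: "c 0 = 0"
  shows "seq_ad c X Y k = seq_ad c X' Y' k"
  unfolding seq_ad_def
proof (intro sum.cong refl)
  fix p
  show "rscl (c p) ((seq_br X ^^ p) Y k) = rscl (c p) ((seq_br X' ^^ p) Y' k)"
  proof (cases p)
    case 0
    then show ?thesis using c0 by simp
  next
    case (Suc q)
    then show ?thesis using seq_br_funpow_local'[of k X X' Y Y' q] X Y X0 by simp
  qed
qed

lemma seq_ad_local_left:
  assumes X: "\<And>i. i \<le> k \<Longrightarrow> X i = X' i"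
  shows "seq_ad c X Y k = seq_ad c X' Y k"
  unfolding seq_ad_def using seq_br_funpow_local[of k X X' Y Y k] X by simp

definition EM :: "nat \<Rightarrow> 'g fps fps" where
  "EM k = evc (sol_minus k)"

definition EP :: "nat \<Rightarrow> 'g fps fps" where
  "EP k = evc (sol_plus k)"

definition rhs :: "nat \<Rightarrow> 'g fps fps" where
  "rhs k = seq_ad (\<lambda>p. (- 1) ^ p / fact p) EM (seq_source a b) k
     + seq_ad (\<lambda>p. if p = 0 then 0 else - ((- 1) ^ p / fact (Suc p))) EM (seq_deriv EM) k
     + seq_ad (\<lambda>p. if p = 0 then 0 else - (1 / fact (Suc p))) EP (seq_deriv EP) k"

lemma EM_0: "EM 0 = 0" "EP 0 = 0"
  by (simp_all add: EM_def EP_def sol_0)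

lemma EM_1: "EM (Suc 0) = a" "EP (Suc 0) = b"
  by (simp_all add: EM_def EP_def sol_1 evc_Cons)

lemma EM_Suc_Suc:
  "EM (Suc (Suc j)) = rscl (1 / of_nat (Suc (Suc j))) (projM (rhs (Suc j)))"
  "EP (Suc (Suc j)) = rscl (1 / of_nat (Suc (Suc j))) (projP (rhs (Suc j)))"
proof -
  let ?A = "fst (gr_solution j)" and ?B = "snd (gr_solution j)"
  have eq: "evc (?A k) = EM k" "evc (?B k) = EP k" if "k \<le> Suc j" for k
    using gr_solution_eq_sol[OF that] by (simp_all add: EM_def EP_def)
  \<comment> \<open>By locality only entries up to \<open>Suc j\<close> matter, and stage
    \<open>j\<close> has these in final form.\<close>
  have "evc (gr_rhs ?A ?B (Suc j)) = rhs (Suc j)"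
    unfolding evc_gr_rhs rhs_def
    by (intro arg_cong2[where f = plus] seq_ad_local seq_ad_local_left)
      (auto simp: eq EM_0 seq_deriv_def)
  then show "EM (Suc (Suc j)) = rscl (1 / of_nat (Suc (Suc j))) (projM (rhs (Suc j)))"
    "EP (Suc (Suc j)) = rscl (1 / of_nat (Suc (Suc j))) (projP (rhs (Suc j)))"
    unfolding EM_def EP_def sol_Suc_Suc evc_map evc_scale ser2_proj_scale by simp_all
qed

lemma seq_deriv_EM:
  "seq_deriv EM (Suc j) = projM (rhs (Suc j))" "seq_deriv EP (Suc j) = projP (rhs (Suc j))"
proof -
  have "of_rat (of_nat (Suc (Suc j))) * of_rat (1 / of_nat (Suc (Suc j))) = (1 :: 'f)"
    unfolding of_rat_mult[symmetric] by (simp del: of_nat_Suc)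
  then show "seq_deriv EM (Suc j) = projM (rhs (Suc j))" "seq_deriv EP (Suc j) = projP (rhs (Suc j))"
    unfolding seq_deriv_def EM_Suc_Suc ser.scale_scale by simp_all
qed

lemma seq_ad_split:
  "seq_ad c X Y k = rscl (c 0) (Y k) - seq_ad (\<lambda>p. if p = 0 then 0 else - c p) X Y k"
  unfolding seq_ad_def
  by (subst (1 2) sum.atMost_shift)
    (simp add: of_rat_minus sum_negf del: funpow.simps)

text \<open>The two projections of \<open>rhs k\<close> add up to \<open>rhs k\<close>, so the two
  halves of the recursion restore one equation. The terms with \<open>p > 0\<close> then return to
  the left-hand side.\<close>

lemma recursion:
  "seq_ad (\<lambda>p. (- 1) ^ p / fact (Suc p)) EM (seq_deriv EM) k
     + seq_ad (\<lambda>p. 1 / fact (Suc p)) EP (seq_deriv EP) k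
   = seq_ad (\<lambda>p. (- 1) ^ p / fact p) EM (seq_source a b) k"
proof (cases k)
  \<comment> \<open>In degree 0 both sides are \<open>a + b\<close>, by the initial values.\<close>
  case 0
  then show ?thesis by (simp add: seq_ad_def seq_deriv_def seq_source_def EM_1)
next
  case (Suc j)
  have "seq_ad (\<lambda>p. (- 1) ^ p / fact (Suc p)) EM (seq_deriv EM) k
     + seq_ad (\<lambda>p. 1 / fact (Suc p)) EP (seq_deriv EP) k =
     (seq_deriv EM k + seq_deriv EP k)
     - seq_ad (\<lambda>p. if p = 0 then 0 else - ((- 1) ^ p / fact (Suc p))) EM (seq_deriv EM) k
     - seq_ad (\<lambda>p. if p = 0 then 0 else - (1 / fact (Suc p))) EP (seq_deriv EP) k"
    by (subst (1 2) seq_ad_split) (simp del: fact_Suc)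
  also have "seq_deriv EM k + seq_deriv EP k = rhs k"
    by (simp add: Suc seq_deriv_EM ser2_proj_sum)
  finally show ?thesis by (simp add: rhs_def)
qed

section \<open>Supports and bidegrees of evaluated words\<close>

lemma evw_support: "\<not> (fst (bideg w) \<le> i \<and> snd (bideg w) \<le> j) \<Longrightarrow> evw w $ i $ j = 0"
proof (induct w arbitrary: i j)
  case WA
  then show ?case using a_nth_0 by (cases i) auto
next
  case WB
  then show ?case using b_nth_0 by (cases j) auto
next
  case (WBr v w)
  have "br (evw v $ k $ l) (evw w $ (i - k) $ (j - l)) = 0" if "k \<le> i" "l \<le> j" for k l
  proof (cases "fst (bideg v) \<le> k \<and> snd (bideg v) \<le> l")
    case True
    then have "\<not> (fst (bideg w) \<le> i - k \<and> snd (bideg w) \<le> j - l)" using WBr(3) that by auto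
    then show ?thesis using WBr(2) by (simp add: br_zero)
  next
    case False
    then show ?thesis using WBr(1) by (simp add: br_zero)
  qed
  then show ?case by (simp add: ser2_br_def)
qed (simp_all add: ser2_proj_def proj_along_zero)

text \<open>One projection fixes \<open>a\<close> and the other kills it, and a bracket of equal
  series is zero. So a word in \<open>a\<close> alone never leaves {0, a}, and likewise for
  \<open>b\<close>.\<close>

lemma evw_pure:
  "snd (bideg w) = 0 \<Longrightarrow> evw w = 0 \<or> (evw w = a \<and> fst (bideg w) = 1)"
  "fst (bideg w) = 0 \<Longrightarrow> evw w = 0 \<or> (evw w = b \<and> snd (bideg w) = 1)"
proof (induct w)
  case (WBr v w)
  {
    case 1
    then show ?case using WBr by (auto simp: ser2_br_zero ser2_br_self)
  next
    case 2
    then show ?case using WBr by (auto simp: ser2_br_zero ser2_br_self)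
  }
next
  case (WPm w)
  {
    case 1
    then show ?case using WPm a_in by (auto simp: ser2_proj_zero ser2_proj_gM)
  next
    case 2
    then show ?case using WPm b_in by (auto simp: ser2_proj_zero ser2_proj_gP)
  }
next
  case (WPp w)
  {
    case 1
    then show ?case using WPp a_in by (auto simp: ser2_proj_zero ser2_proj_gM)
  next
    case 2
    then show ?case using WPp b_in by (auto simp: ser2_proj_zero ser2_proj_gP)
  }
qed auto

abbreviation part :: "nat \<Rightarrow> nat \<Rightarrow> word_comb \<Rightarrow> word_comb" where
  "part m n \<equiv> filter (\<lambda>(c, w). bideg w = (m, n))"

lemma evc_parts_nth:
  assumes "finite S" "\<And>c w. (c, w) \<in> set xs \<Longrightarrow> bideg w \<in> S \<or> evw w $ i $ j = 0"
  shows "evc xs $ i $ j = (\<Sum>(m, n)\<in>S. evc (part m n xs) $ i $ j)"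
  using assms(2)
proof (induct xs)
  case (Cons x xs)
  obtain c w where x: "x = (c, w)" by (cases x)
  have IH: "evc xs $ i $ j = (\<Sum>(m, n)\<in>S. evc (part m n xs) $ i $ j)"
    using Cons by auto
  have "(\<Sum>(m, n)\<in>S. evc (part m n (x # xs)) $ i $ j) =
      (\<Sum>q\<in>S. (if q = bideg w then rscl c (evw w) $ i $ j else 0)
        + evc (part (fst q) (snd q) xs) $ i $ j)"
    by (rule sum.cong) (auto simp: x evc_Cons)
  also have "\<dots> = (if bideg w \<in> S then rscl c (evw w) $ i $ j else 0) + evc xs $ i $ j"
    by (simp add: sum.distrib assms(1) IH split_def)
  also have "\<dots> = evc (x # xs) $ i $ j"
    using Cons(2)[of c w] by (auto simp: x evc_Cons ser2_scl_def)
  finally show ?case by simp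
qed simp

lemma evc_support:
  assumes "\<And>c w. (c, w) \<in> set xs \<Longrightarrow> \<not> (fst (bideg w) \<le> i \<and> snd (bideg w) \<le> j)"
  shows "evc xs $ i $ j = 0"
proof -
  have "evc xs $ i $ j = (\<Sum>(m, n)\<in>{}. evc (part m n xs) $ i $ j)"
    using assms evw_support by (intro evc_parts_nth) auto
  then show ?thesis by simp
qed

lemma evc_in_word_span:
  assumes "\<And>c w. (c, w) \<in> set xs \<Longrightarrow> bideg w = (m, n)"
  shows "evc xs \<in> word_span scl br gM gP a b m n"
  using assms unfolding word_span_def
proof (induct xs)
  case (Cons x xs)
  obtain c w where x: "x = (c, w)" by (cases x)
  have "evw w \<in> ser.span {evw w |w. bideg w = (m, n)}"
    using Cons(2)[of c w] by (intro ser.span_base) (auto simp: x)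
  then show ?case
    using Cons by (auto simp: x evc_Cons intro!: ser.span_add ser.span_scale)
qed (simp add: ser.span_zero)

lemma part_in_word_span: "evc (part m n xs) \<in> word_span scl br gM gP a b m n"
  by (rule evc_in_word_span) auto

text \<open>Setting u = 1 collects words by letter count, the canonical series by bidegree; this
  regroups one into the other. Words with more than \<open>i + j\<close> letters do not reach the
  coefficient, hence any larger \<open>N\<close>.\<close>

lemma ser2_sum_parts_nth:
  assumes hom: "homogeneous 0 C" and N: "i + j \<le> N"
  shows "ser2_sum (\<lambda>m n. evc (part m n (C (m + n)))) $ i $ j = (\<Sum>k\<le>N. evc (C k) $ i $ j)"
proof -
  let ?f = "\<lambda>m n. evc (part m n (C (m + n))) $ i $ j"
  define S where "S k = {(m, n). m \<le> i \<and> n \<le> j \<and> m + n = k}" for k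
  have fin: "finite (S k)" for k
    by (rule finite_subset[of _ "{..i} \<times> {..j}"]) (auto simp: S_def)
  have "evc (C k) $ i $ j = (\<Sum>(m, n)\<in>S k. ?f m n)" for k
  proof -
    have "evc (C k) $ i $ j = (\<Sum>(m, n)\<in>S k. evc (part m n (C k)) $ i $ j)"
    proof (rule evc_parts_nth[OF fin])
      fix c w assume "(c, w) \<in> set (C k)"
      then have "tdeg w = k" using hom by (auto simp: homogeneous_def)
      then show "bideg w \<in> S k \<or> evw w $ i $ j = 0"
        using evw_support[of w i j] by (cases "bideg w") (auto simp: S_def tdeg_def)
    qed
    also have "\<dots> = (\<Sum>(m, n)\<in>S k. ?f m n)"
      by (rule sum.cong) (auto simp: S_def)
    finally show ?thesis .
  qed
  then have "(\<Sum>k\<le>N. evc (C k) $ i $ j) = (\<Sum>k\<le>N. \<Sum>q\<in>S k. case q of (m, n) \<Rightarrow> ?f m n)"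
    by simp
  also have "\<dots> = (\<Sum>(k, q)\<in>Sigma {..N} S. case q of (m, n) \<Rightarrow> ?f m n)"
    by (rule sum.Sigma) (simp_all add: fin)
  also have "\<dots> = (\<Sum>(m, n)\<in>{..i} \<times> {..j}. ?f m n)"
    using N
    by (intro sum.reindex_bij_witness[of _ "\<lambda>(m, n). (m + n, m, n)" snd]) (auto simp: S_def)
  finally show ?thesis by (simp add: ser2_sum_def sum.cartesian_product)
qed

lemma ser2_sum_in_word_series:
  "ser2_sum (\<lambda>m n. evc (part m n (C (m + n)))) \<in> word_series scl br gM gP a b"
  unfolding word_series_def using part_in_word_span by blast

text \<open>The witness for the remainders of order at least three.\<close>

definition higher_part :: "(nat \<Rightarrow> word_comb) \<Rightarrow> 'g fps fps" where
  "higher_part C = ser2_sum (\<lambda>m n. if 1 \<le> m \<and> 1 \<le> n \<and> 3 \<le> m + n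
     then evc (part m n (C (m + n))) else 0)"

lemma higher_part_in:
  "higher_part C \<in> word_series scl br gM gP a b"
  "higher_part C \<in> word_series_on (\<lambda>m n. 1 \<le> m \<and> 1 \<le> n \<and> 3 \<le> m + n) scl br gM gP a b"
proof -
  let ?w = "\<lambda>m n. if 1 \<le> m \<and> 1 \<le> n \<and> 3 \<le> m + n then evc (part m n (C (m + n))) else 0"
  have "0 \<in> word_span scl br gM gP a b m n" for m n
    using evc_in_word_span[of "[]"] by simp
  then have "?w m n \<in> word_span scl br gM gP a b m n" for m n
    using part_in_word_span by simp
  then show "higher_part C \<in> word_series scl br gM gP a b"
    unfolding word_series_def higher_part_def by blast
  show "higher_part C \<in> word_series_on (\<lambda>m n. 1 \<le> m \<and> 1 \<le> n \<and> 3 \<le> m + n) scl br gM gP a b"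
    unfolding word_series_on_def higher_part_def mem_Collect_eq
    by (rule exI[of _ ?w]) (use part_in_word_span in simp)
qed

lemma evc_part_pure:
  assumes "m = 0 \<and> n \<noteq> 1 \<or> n = 0 \<and> m \<noteq> 1"
  shows "evc (part m n xs) = 0"
proof (induct xs)
  case (Cons x xs)
  obtain c w where x: "x = (c, w)" by (cases x)
  have "evw w = 0" if "bideg w = (m, n)"
    using evw_pure[of w] assms that by auto
  then show ?case using Cons by (simp add: x evc_Cons)
qed simp

text \<open>
  A pure word of degree at least two vanishes, since it contains a bracket of two multiples of the
  same series; so the bidegree \<open>(1, 1)\<close> part of \<open>C 2\<close> is all of it.
\<close>

lemma evc_part_1_1:
  assumes "homogeneous 0 C"
  shows "evc (part 1 1 (C 2)) = evc (C 2)"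
proof (rule ser2_eqI)
  fix i j
  let ?S = "{(2, 0), (1, 1), (0, 2)} :: (nat \<times> nat) set"
  have "evc (C 2) $ i $ j = (\<Sum>(m, n)\<in>?S. evc (part m n (C 2)) $ i $ j)"
  proof (rule evc_parts_nth)
    fix c w assume "(c, w) \<in> set (C 2)"
    then have "tdeg w = 2" using assms by (auto simp: homogeneous_def)
    then have "bideg w \<in> ?S"
      by (cases "bideg w") (auto simp: tdeg_def)
    then show "bideg w \<in> ?S \<or> evw w $ i $ j = 0" by simp
  qed simp
  then show "evc (part 1 1 (C 2)) $ i $ j = evc (C 2) $ i $ j"
    using evc_part_pure[of 2 0] evc_part_pure[of 0 2] by simp
qed

lemma ser2_sum_lowest_order:
  assumes hom: "homogeneous 0 C"
  shows "ser2_sum (\<lambda>m n. evc (part m n (C (m + n)))) = evc (C 1) + evc (C 2) + higher_part C"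
proof (rule ser2_eqI)
  fix i j
  let ?f = "\<lambda>m n. evc (part m n (C (m + n)))"
  let ?h = "\<lambda>m n. if 1 \<le> m \<and> 1 \<le> n \<and> 3 \<le> m + n then ?f m n else 0"
  have supp: "?f m n $ i $ j = 0" if "\<not> (m \<le> i \<and> n \<le> j)" for m n
    by (rule evc_support) (use that in auto)
  let ?S = "{(1, 0), (0, 1)} :: (nat \<times> nat) set"
  have "evc (C 1) $ i $ j = (\<Sum>(m, n)\<in>?S. evc (part m n (C 1)) $ i $ j)"
  proof (rule evc_parts_nth)
    fix c w assume "(c, w) \<in> set (C 1)"
    then have "tdeg w = 1" using hom by (auto simp: homogeneous_def)
    then have "bideg w \<in> ?S" by (cases "bideg w") (auto simp: tdeg_def)
    then show "bideg w \<in> ?S \<or> evw w $ i $ j = 0" by simp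
  qed simp
  then have C1: "evc (C 1) $ i $ j = ?f 1 0 $ i $ j + ?f 0 1 $ i $ j" by simp
  have C2: "evc (C 2) $ i $ j = ?f 1 1 $ i $ j"
    using evc_part_1_1[OF hom] by (simp add: numeral_2_eq_2)
  let ?K = "{(1, 0), (0, 1), (1, 1)} :: (nat \<times> nat) set"
  \<comment> \<open>A bidegree outside \<open>?K\<close> is either counted by \<open>?h\<close> or
    has a zero entry and total degree other than one, (0, 0) included; its part then
    vanishes.\<close>
  have split: "?f m n $ i $ j = ?h m n $ i $ j + (if (m, n) \<in> ?K then ?f m n $ i $ j else 0)" for m n
  proof (cases "m = 0 \<or> n = 0")
    case True
    then show ?thesis using evc_part_pure[of m n "C (m + n)"] by auto
  next
    case False
    then have "m + n \<ge> 3 \<or> m = 1 \<and> n = 1" by arith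
    then show ?thesis using False by auto
  qed
  have "(\<Sum>m\<le>i. \<Sum>n\<le>j. ?f m n $ i $ j) = (\<Sum>(m, n)\<in>{..i} \<times> {..j}. ?f m n $ i $ j)"
    by (rule sum.cartesian_product)
  also have "\<dots> = (\<Sum>q\<in>{..i} \<times> {..j}. ?h (fst q) (snd q) $ i $ j
      + (if q \<in> ?K then ?f (fst q) (snd q) $ i $ j else 0))"
  proof (rule sum.cong[OF refl])
    fix q
    show "(case q of (m, n) \<Rightarrow> ?f m n $ i $ j) = ?h (fst q) (snd q) $ i $ j
      + (if q \<in> ?K then ?f (fst q) (snd q) $ i $ j else 0)"
      using split[of "fst q" "snd q"] by (cases q) (simp only: prod.case fst_conv snd_conv)
  qed
  also have "\<dots> = (\<Sum>m\<le>i. \<Sum>n\<le>j. ?h m n $ i $ j)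
     + (\<Sum>q\<in>{..i} \<times> {..j}. if q \<in> ?K then ?f (fst q) (snd q) $ i $ j else 0)"
    by (simp only: sum.distrib sum.cartesian_product split_def)
  \<comment> \<open>The box of indices may miss some of the three bidegrees, but a missing one
    contributes nothing here by \<open>supp\<close>.\<close>
  also have "(\<Sum>q\<in>{..i} \<times> {..j}. if q \<in> ?K then ?f (fst q) (snd q) $ i $ j else 0)
     = (\<Sum>q\<in>?K. ?f (fst q) (snd q) $ i $ j)"
  proof -
    have "(\<Sum>q\<in>{..i} \<times> {..j}. if q \<in> ?K then ?f (fst q) (snd q) $ i $ j else 0)
      = (\<Sum>q\<in>{..i} \<times> {..j} \<inter> ?K. ?f (fst q) (snd q) $ i $ j)"
      by (rule sum.inter_restrict[symmetric]) simp
    also have "\<dots> = (\<Sum>q\<in>?K. ?f (fst q) (snd q) $ i $ j)"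
    proof (rule sum.mono_neutral_left)
      show "\<forall>q\<in>?K - {..i} \<times> {..j} \<inter> ?K. ?f (fst q) (snd q) $ i $ j = 0"
      proof
        fix q assume "q \<in> ?K - {..i} \<times> {..j} \<inter> ?K"
        then have "\<not> (fst q \<le> i \<and> snd q \<le> j)" by (cases q) auto
        then show "?f (fst q) (snd q) $ i $ j = 0" by (rule supp)
      qed
    qed auto
    finally show ?thesis .
  qed
  finally show "ser2_sum ?f $ i $ j = (evc (C 1) + evc (C 2) + higher_part C) $ i $ j"
    unfolding higher_part_def fps_add_nth C1 C2
    by (simp add: ser2_sum_def add_ac)
qed

text \<open>The source contributes \<open>[b, a]\<close>, and \<open>- ad a\<close> on its degree 0
  part \<open>a + b\<close> contributes a second copy; the derivative terms are
  \<open>[a, a]\<close> and \<open>[b, b]\<close>. The factor 2 cancels against the division in the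
  recursion.\<close>

lemma rhs_1: "rhs 1 = rscl 2 (ser2_br br b a)"
proof -
  have "seq_br X Y 1 = ser2_br br (X 1) (Y 0)" if "X 0 = 0" for X Y
    using that by (simp add: seq_br_def ser2_br_zero)
  then have "rhs 1 = ser2_br br b a + rscl (- 1) (ser2_br br a (a + b))"
    by (simp add: rhs_def seq_ad_def EM_0 EM_1 seq_source_def seq_deriv_def ser2_br_self)
  also have "\<dots> = ser2_br br b a + ser2_br br b a"
    using ser2_br_anti[of b a] by (simp add: ser2_br_add_right ser2_br_self of_rat_minus)
  also have "\<dots> = rscl 2 (ser2_br br b a)"
    using ser.scale_left_distrib[of 1 1 "ser2_br br b a"] by simp
  finally show ?thesis .
qed

lemma EM_2: "EM 2 = projM (ser2_br br b a)" "EP 2 = projP (ser2_br br b a)"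
proof -
  have "of_rat (1 / 2) * of_rat 2 = (1 :: 'f)"
    unfolding of_rat_mult[symmetric] by simp
  then show "EM 2 = projM (ser2_br br b a)" "EP 2 = projP (ser2_br br b a)"
    using EM_Suc_Suc[of 0] rhs_1 by (simp_all add: ser2_proj_scale numeral_2_eq_2)
qed

lemma EM_in: "EM k \<in> ser2_in gM" "EP k \<in> ser2_in gP"
proof -
  have z: "0 \<in> ser2_in gM" "0 \<in> ser2_in gP"
    using subspace_0[OF subspace_gM] subspace_0[OF subspace_gP] by (simp_all add: ser2_in_def)
  have SS: "EM (Suc (Suc j)) \<in> ser2_in gM" "EP (Suc (Suc j)) \<in> ser2_in gP" for j
    unfolding EM_Suc_Suc ser2_proj_scale[symmetric] by (rule ser2_proj_in)+
  have "EM k \<in> ser2_in gM \<and> EP k \<in> ser2_in gP"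
  proof (cases k)
    case (Suc l)
    then show ?thesis using a_in b_in SS by (cases l) (simp_all add: EM_1)
  qed (use z EM_0 in simp)
  then show "EM k \<in> ser2_in gM" "EP k \<in> ser2_in gP" by simp_all
qed

section \<open>The evaluated canonical series and the factorization\<close>

definition GM :: "'g fps fps" where
  "GM = eval_series scl br gM gP a b G_minus"

definition GP :: "'g fps fps" where
  "GP = eval_series scl br gM gP a b G_plus"

lemma GM_eq: "GM = ser2_sum (\<lambda>m n. evc (part m n (sol_minus (m + n))))"
  "GP = ser2_sum (\<lambda>m n. evc (part m n (sol_plus (m + n))))"
  by (simp_all add: GM_def GP_def eval_series_def G_minus_eq G_plus_eq)

lemma GM_nth:
  assumes "i + j \<le> N"
  shows "GM $ i $ j = (\<Sum>k\<le>N. EM k $ i $ j)" "GP $ i $ j = (\<Sum>k\<le>N. EP k $ i $ j)"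
  unfolding GM_eq EM_def EP_def by (rule ser2_sum_parts_nth[OF homogeneous_sol(1) assms]
      ser2_sum_parts_nth[OF homogeneous_sol(2) assms])+

lemma GM_in: "GM \<in> ser2_in gM" "GP \<in> ser2_in gP"
  using EM_in
  by (auto simp: ser2_in_def GM_nth[OF order_refl]
      intro!: subspace_sum[OF subspace_gM] subspace_sum[OF subspace_gP])

lemma GM_lowest_order:
  "GM = a + projM (ser2_br br b a) + higher_part sol_minus"
  "GP = b + projP (ser2_br br b a) + higher_part sol_plus"
  using ser2_sum_lowest_order[OF homogeneous_sol(1)] ser2_sum_lowest_order[OF homogeneous_sol(2)]
    EM_2 EM_1 by (simp_all add: GM_eq EM_def EP_def)

text \<open>Read off from the lowest-order formula: the remainder is a difference of elements of the
  same summand.\<close>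

lemma higher_part_in_summand: "higher_part sol_minus \<in> ser2_in gM" "higher_part sol_plus \<in> ser2_in gP"
proof -
  have diff: "X - Y - Z \<in> ser2_in V" if "subspace V" "X \<in> ser2_in V" "Y \<in> ser2_in V" "Z \<in> ser2_in V"
    for X Y Z V
    using that by (auto simp: ser2_in_def intro!: subspace_diff)
  have "higher_part sol_minus = GM - a - projM (ser2_br br b a)"
    "higher_part sol_plus = GP - b - projP (ser2_br br b a)"
    using GM_lowest_order by (simp_all add: algebra_simps)
  then show "higher_part sol_minus \<in> ser2_in gM" "higher_part sol_plus \<in> ser2_in gP"
    using diff[OF subspace_gM GM_in(1) a_in ser2_proj_in(1)]
      diff[OF subspace_gP GM_in(2) b_in ser2_proj_in(2)] by simp_all
qed

lemma emb_EM: "emb (EM k) \<in> deg_ideal k" "emb (EP k) \<in> deg_ideal k"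
proof -
  have "evc (C k) $ i $ j = 0" if "homogeneous 0 C" "i + j < k" for C i j
  proof (rule evc_support)
    fix c w assume "(c, w) \<in> set (C k)"
    then have "tdeg w = k" using that by (auto simp: homogeneous_def)
    then show "\<not> (fst (bideg w) \<le> i \<and> snd (bideg w) \<le> j)" using that by (simp add: tdeg_def)
  qed
  then show "emb (EM k) \<in> deg_ideal k" "emb (EP k) \<in> deg_ideal k"
    unfolding EM_def EP_def using homogeneous_sol by (intro emb_deg_ideal; blast)+
qed

lemma emb_GM_cong:
  "st.cong (Suc N) (\<Sum>k\<le>N. emb (EM k)) (emb GM)" "st.cong (Suc N) (\<Sum>k\<le>N. emb (EP k)) (emb GP)"
proof -
  have "st.cong (Suc N) (\<Sum>k\<le>N. emb (E k)) (emb G)"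
    if "\<And>i j. i + j \<le> N \<Longrightarrow> G $ i $ j = (\<Sum>k\<le>N. E k $ i $ j)" for E G
  proof -
    have "st.cong (Suc N) (\<Sum>k\<le>N. emb (E k)) (emb (\<Sum>k\<le>N. E k))"
      unfolding st.cong_def
      using coeff_ideal_deg_ideal[OF coeff_ideal_neg[OF emb_sum[of E "{..N}"]]] by simp
    also have "st.cong (Suc N) (emb (\<Sum>k\<le>N. E k)) (emb G)"
      by (simp add: st.cong_def deg_ideal_def ser2_gen_def sum_nth_nth that UI_zero)
    finally show ?thesis .
  qed
  then show "st.cong (Suc N) (\<Sum>k\<le>N. emb (EM k)) (emb GM)"
    "st.cong (Suc N) (\<Sum>k\<le>N. emb (EP k)) (emb GP)"
    using GM_nth by blast+
qed

theorem canonical_factorization: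
  "st.cong (Suc (Suc N))
    (st.trunc_exp (Suc N) (emb b) * st.trunc_exp (Suc N) (emb a))
    (st.trunc_exp (Suc N) (emb GM) * st.trunc_exp (Suc N) (emb GP))"
proof -
  have "emb a \<in> deg_ideal 1" "emb b \<in> deg_ideal 1"
    using a_nth_0 b_nth_0 by (auto intro!: emb_deg_ideal)
  from lie_factorization[OF EM_0 emb_EM this recursion]
  show ?thesis
    by (rule st.cong_trans) (intro st.cong_mult st.trunc_exp_cong emb_GM_cong)
qed

theorem factors_eq_evaluation:
  assumes X: "X \<in> ser2_in gM" "X $ 0 $ 0 = 0" and Y: "Y \<in> ser2_in gP" "Y $ 0 $ 0 = 0"
    and eq: "uea_ser2_eq scl br (ser2_exp (emb b) * ser2_exp (emb a)) (ser2_exp (emb X) * ser2_exp (emb Y))"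
  shows "X = GM \<and> Y = GP"
proof (rule factorization_unique)
  \<comment> \<open>The solution has no term in letter count 0.\<close>
  have "GM $ 0 $ 0 = 0" "GP $ 0 $ 0 = 0"
    using GM_nth[of 0 0 0] by (simp_all add: EM_0)
  then show "GM $ 0 $ 0 = 0" "GP $ 0 $ 0 = 0" .
  fix N
  let ?e = "st.trunc_exp (Suc N)"
  have exp: "st.cong (Suc (Suc N)) (ser2_exp (emb Z)) (?e (emb Z))" if "Z $ 0 $ 0 = 0" for Z
    using that by (auto intro!: ser2_exp_cong emb_deg_ideal)
  have "st.cong (Suc (Suc N)) (?e (emb X) * ?e (emb Y)) (ser2_exp (emb X) * ser2_exp (emb Y))"
    using X Y by (intro st.cong_mult st.cong_sym[OF exp])
  also have "st.cong (Suc (Suc N)) \<dots> (ser2_exp (emb b) * ser2_exp (emb a))"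
    using eq by (intro st.cong_sym[of _ "ser2_exp (emb b) * _"])
      (auto simp: uea_ser2_eq_def st.cong_def deg_ideal_def)
  also have "st.cong (Suc (Suc N)) \<dots> (?e (emb b) * ?e (emb a))"
    using a_nth_0 b_nth_0 by (intro st.cong_mult exp)
  also note canonical_factorization
  finally show "st.cong (Suc (Suc N)) (?e (emb X) * ?e (emb Y)) (?e (emb GM) * ?e (emb GP))" .
qed (use X Y GM_in in auto)

end

theorem corollary3p13:
  "canonical_series G_minus \<and> canonical_series G_plus \<and>
   (\<forall>(scl :: 'f::field_char_0 \<Rightarrow> 'g::ab_group_add \<Rightarrow> 'g) br gM gP xM xP PsiM PsiP.
      lie_decomposition scl br gM gP \<longrightarrow>
      xM \<in> ser2_in gM \<longrightarrow> xP \<in> ser2_in gP \<longrightarrow>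
      PsiM \<in> ser2_in gM \<longrightarrow> PsiP \<in> ser2_in gP \<longrightarrow>
      uea_ser2_eq scl br
        (ser2_exp (ser2_gen (t_mult xP)) * ser2_exp (ser2_gen (s_mult xM)))
        (ser2_exp (ser2_gen (s_mult PsiM)) * ser2_exp (ser2_gen (t_mult PsiP))) \<longrightarrow>
      (let a = s_mult xM; b = t_mult xP;
           W = word_series scl br gM gP a b;
           W3 = word_series_on (\<lambda>m n. 1 \<le> m \<and> 1 \<le> n \<and> 3 \<le> m + n) scl br gM gP a b;
           GM = eval_series scl br gM gP a b G_minus;
           GP = eval_series scl br gM gP a b G_plus
       in s_mult PsiM \<in> W \<and> t_mult PsiP \<in> W \<and>
          s_mult PsiM = GM \<and> t_mult PsiP = GP \<and>
          (\<exists>vM \<in> W \<inter> ser2_in gM \<inter> W3.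
             GM = a + ser2_proj gM gP (ser2_br br b a) + vM) \<and>
          (\<exists>vP \<in> W \<inter> ser2_in gP \<inter> W3.
             GP = b + ser2_proj gP gM (ser2_br br b a) + vP)))"
proof (intro conjI allI impI)
  show "canonical_series G_minus" "canonical_series G_plus"
    by (auto simp: canonical_series_def G_minus_def G_plus_def)
  fix scl :: "'f \<Rightarrow> 'g \<Rightarrow> 'g" and br gM gP xM xP PsiM PsiP
  assume dec: "lie_decomposition scl br gM gP"
    and x: "xM \<in> ser2_in gM" "xP \<in> ser2_in gP"
    and Psi: "PsiM \<in> ser2_in gM" "PsiP \<in> ser2_in gP"
    and eq: "uea_ser2_eq scl br
        (ser2_exp (ser2_gen (t_mult xP)) * ser2_exp (ser2_gen (s_mult xM)))
        (ser2_exp (ser2_gen (s_mult PsiM)) * ser2_exp (ser2_gen (t_mult PsiP)))"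
  interpret lie_decomposition_char_0 scl br gM gP
    using dec by (simp add: lie_decomposition_char_0_def)
  have shift: "s_mult Z \<in> ser2_in gM" if "Z \<in> ser2_in gM" for Z
    using that subspace_0[OF subspace_gM] by (auto simp: ser2_in_def s_mult_def)
  have shift': "t_mult Z \<in> ser2_in gP" if "Z \<in> ser2_in gP" for Z
    using that subspace_0[OF subspace_gP] by (auto simp: ser2_in_def t_mult_def)
  \<comment> \<open>The shifts by s and t supply the vanishing conditions \<open>a_nth_0\<close> and
    \<open>b_nth_0\<close>.\<close>
  interpret word_evaluation scl br gM gP "s_mult xM" "t_mult xP"
    using shift[OF x(1)] shift'[OF x(2)] by unfold_locales (simp_all add: s_mult_def t_mult_def)
  have "s_mult PsiM = GM \<and> t_mult PsiP = GP"
    by (rule factors_eq_evaluation[OF shift[OF Psi(1)] _ shift'[OF Psi(2)] _ eq])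
      (simp_all add: s_mult_def t_mult_def)
  then show "let a = s_mult xM; b = t_mult xP;
           W = word_series scl br gM gP a b;
           W3 = word_series_on (\<lambda>m n. 1 \<le> m \<and> 1 \<le> n \<and> 3 \<le> m + n) scl br gM gP a b;
           GM = eval_series scl br gM gP a b G_minus;
           GP = eval_series scl br gM gP a b G_plus
       in s_mult PsiM \<in> W \<and> t_mult PsiP \<in> W \<and>
          s_mult PsiM = GM \<and> t_mult PsiP = GP \<and>
          (\<exists>vM \<in> W \<inter> ser2_in gM \<inter> W3.
             GM = a + ser2_proj gM gP (ser2_br br b a) + vM) \<and>
          (\<exists>vP \<in> W \<inter> ser2_in gP \<inter> W3.
             GP = b + ser2_proj gP gM (ser2_br br b a) + vP)"
    unfolding Let_def GM_def[symmetric] GP_def[symmetric]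
    using ser2_sum_in_word_series[of sol_minus] ser2_sum_in_word_series[of sol_plus]
      GM_lowest_order higher_part_in[of sol_minus] higher_part_in[of sol_plus]
      higher_part_in_summand
    by (auto simp: GM_eq[symmetric])
qed

end
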